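(* Let $B_1 = (B_1(t))_{t\in\mathbb{R}}$ and $B_2 = (B_2(t))_{t\in\mathbb{R}}$ be independent two-sided standard Brownian motions. Let $\phi_1,\phi_2:\mathbb{R}\to\mathbb{R}$ be deterministic functions, each having an $L^2$ derivative (that is, each is locally absolutely continuous with derivative in $L^2(\mathbb{R})$). Let $\sigma,\rho_1,\rho_2\in\mathbb{R}$ be constants with $\sigma\neq 0$ and $\rho_2\neq 0$. Define, for $t\in\mathbb{R}$, $$X_1(t) = \phi_1(t) + \sigma B_1(t), \qquad X_2(t) = \phi_2(t) + \rho_1 B_1(t) + \rho_2 B_2(t).$$ Then, with probability one, there does not exist $t\in\mathbb{R}$ such that $t$ is a local maximum for $X_1$ and also a local maximum for $X_2$.
   Context: A two-sided standard Brownian motion is a real-valued process $(B(t))_{t\in\mathbb{R}}$ with continuous sample paths and $B(0)=0$ such that $(B(t))_{t\ge 0}$ and $(B(-t))_{t\ge 0}$ are independent standard Brownian motions. A time $s\in\mathbb{R}$ is a local maximum for a function $f:\mathbb{R}\to\mathbb{R}$ if there exists $\eta>0$ such that $f(t)\le f(s)$ for all $t\in(s-\eta,s+\eta)$ (the inequality is not required to be strict). The constant $\rho_1$ may be zero. *)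

theory Defs
  imports "HOL-Probability.Probability"
begin

text \<open>A process is written \<open>X t \<omega>\<close>, time first. Independence of two processes is independence of the
  path-valued random variables, i.e. of the sigma-algebras generated by all coordinates in \<open>T\<close>.\<close>

definition (in prob_space) indep_processes ::
  "real set \<Rightarrow> (real \<Rightarrow> 'a \<Rightarrow> real) \<Rightarrow> (real \<Rightarrow> 'a \<Rightarrow> real) \<Rightarrow> bool" where
  "indep_processes T X Y \<longleftrightarrow>
     indep_var (Pi\<^sub>M T (\<lambda>_. borel)) (\<lambda>\<omega>. \<lambda>t\<in>T. X t \<omega>)
               (Pi\<^sub>M T (\<lambda>_. borel)) (\<lambda>\<omega>. \<lambda>t\<in>T. Y t \<omega>)"

text \<open>Only the values at times \<open>t \<ge> 0\<close> matter here. The second argument of \<^const>\<open>normal_density\<close> is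
  the standard deviation.\<close>

definition (in prob_space) standard_brownian_motion :: "(real \<Rightarrow> 'a \<Rightarrow> real) \<Rightarrow> bool" where
  "standard_brownian_motion X \<longleftrightarrow>
     (\<forall>t\<ge>0. random_variable borel (X t)) \<and>
     (\<forall>\<omega>\<in>space M. X 0 \<omega> = 0) \<and>
     (\<forall>\<omega>\<in>space M. continuous_on {0..} (\<lambda>t. X t \<omega>)) \<and>
     (\<forall>(n::nat) (t::nat \<Rightarrow> real). 0 \<le> t 0 \<and> strict_mono_on {..n} t \<longrightarrow>
        indep_vars (\<lambda>_. borel) (\<lambda>i \<omega>. X (t (Suc i)) \<omega> - X (t i) \<omega>) {..<n}) \<and>
     (\<forall>s t. 0 \<le> s \<and> s < t \<longrightarrow>
        distributed M lborel (\<lambda>\<omega>. X t \<omega> - X s \<omega>) (normal_density 0 (sqrt (t - s))))"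

definition (in prob_space) two_sided_brownian_motion :: "(real \<Rightarrow> 'a \<Rightarrow> real) \<Rightarrow> bool" where
  "two_sided_brownian_motion B \<longleftrightarrow>
     (\<forall>t. random_variable borel (B t)) \<and>
     (\<forall>\<omega>\<in>space M. B 0 \<omega> = 0) \<and>
     (\<forall>\<omega>\<in>space M. continuous_on UNIV (\<lambda>t. B t \<omega>)) \<and>
     standard_brownian_motion B \<and>
     standard_brownian_motion (\<lambda>t. B (- t)) \<and>
     indep_processes {0..} B (\<lambda>t. B (- t))"

definition absolutely_continuous_on_interval :: "real \<Rightarrow> real \<Rightarrow> (real \<Rightarrow> real) \<Rightarrow> bool" where
  "absolutely_continuous_on_interval a b f \<longleftrightarrow>
     (\<forall>\<epsilon>>0. \<exists>\<delta>>0. \<forall>(n::nat) (u::nat \<Rightarrow> real) (v::nat \<Rightarrow> real).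
        (\<forall>i<n. a \<le> u i \<and> u i \<le> v i \<and> v i \<le> b) \<and>
        disjoint_family_on (\<lambda>i. {u i<..<v i}) {..<n} \<and>
        (\<Sum>i<n. v i - u i) < \<delta> \<longrightarrow>
        (\<Sum>i<n. \<bar>f (v i) - f (u i)\<bar>) < \<epsilon>)"

definition locally_absolutely_continuous :: "(real \<Rightarrow> real) \<Rightarrow> bool" where
  "locally_absolutely_continuous f \<longleftrightarrow> (\<forall>a b. absolutely_continuous_on_interval a b f)"

text \<open>A locally absolutely continuous function is differentiable almost everywhere; \<open>g\<close> below is a
  Borel version of its almost everywhere defined derivative.\<close>

definition has_L2_derivative :: "(real \<Rightarrow> real) \<Rightarrow> bool" where
  "has_L2_derivative f \<longleftrightarrow>
     locally_absolutely_continuous f \<and>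
     (\<exists>g. g \<in> borel_measurable lborel \<and>
          (AE x in lborel. (f has_real_derivative g x) (at x)) \<and>
          integrable lborel (\<lambda>x. (g x)\<^sup>2))"

definition is_local_max :: "(real \<Rightarrow> real) \<Rightarrow> real \<Rightarrow> bool" where
  "is_local_max f s \<longleftrightarrow> (\<exists>\<eta>>0. \<forall>t\<in>{s - \<eta><..<s + \<eta>}. f t \<le> f s)"

end

theory Submission
  imports Defs
begin

text \<open>
  The point of the proof is to look at increments over the times \<open>4^-k\<close> only, whose natural size is
  \<open>2^-k\<close>. A drift with \<open>L^2\<close> derivative is Hoelder continuous of order one half
  (\<open>has_L2_derivative_half_Hoelder\<close>), so it contributes at most \<open>H * 2^-k\<close> to such an increment and
  can be absorbed into the constants in front of \<open>2^-k\<close>.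

  Take a local maximum \<open>t > 0\<close> of \<open>X1\<close>. Three facts rule out that \<open>t\<close> is a local maximum of \<open>X2\<close>.

  First, almost surely every time \<open>t \<ge> 0\<close>, hence also every exceptional one, has infinitely many good
  scales \<open>k\<close>, at which \<open>\<bar>B1 (t + 4^-k) - B1 t\<bar> < 43 * 2^-k\<close>
  (\<open>infinitely_many_small_increments_everywhere\<close>). For a fixed time, the probability of having no good
  scale between \<open>k0\<close> and \<open>n\<close> decays like \<open>32^-n\<close> once the constant is large, which beats the \<open>16^n\<close>
  points of a grid of mesh \<open>16^-n\<close>; a chaining argument passes from the grid to all times.

  Second, \<open>X1\<close> almost surely has different maxima on any two disjoint intervals with rational end points
  (\<open>no_equal_maxima_on_disjoint_intervals\<close>), because the increment of \<open>B1\<close> across the gap between them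
  has a bounded density and is independent of everything else that enters the difference of the two
  maxima. Hence \<open>t\<close> is the only maximum point of \<open>X1\<close> on some rational interval. So there are only
  countably many candidates for \<open>t\<close>, and each is a measurable function of the path of \<open>B1\<close>.

  Third, for a fixed time, a fixed infinite set of scales and any \<open>L\<close>, the increments of
  \<open>\<rho>2 * B2\<close> almost surely exceed \<open>L * 2^-k\<close> infinitely often along that set
  (\<open>infinitely_often_large_increment\<close>). As \<open>B2\<close> is independent of \<open>B1\<close>, Fubini's theorem allows the
  time and the set of scales to be functions of \<open>B1\<close> (\<open>large_increment_at_independent_time\<close>): they may
  be a candidate \<open>t\<close> and its good scales. At those scales the contributions of \<open>\<phi>2\<close> and
  \<open>\<rho>1 * B1\<close> to the increment of \<open>X2\<close> are of order \<open>2^-k\<close>, so for \<open>L\<close> large enough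
  \<open>X2 (t + 4^-k) > X2 t\<close> for infinitely many \<open>k\<close>.

  For \<open>t > 0\<close> the rational interval can be taken inside the positive half line, so this part involves one
  standard Brownian motion in each process, and negative times reduce to positive ones by time reversal. For \<open>t = 0\<close>
  the third fact, applied to \<open>B1\<close>, already shows that \<open>0\<close> is not a local maximum of \<open>X1\<close>.
\<close>

section \<open>Functions with square integrable derivative are Hoelder continuous\<close>

text \<open>
  The fundamental theorem of calculus for the Henstock-Kurzweil integral. The gauge separates two kinds
  of tags: off \<open>N\<close> the usual straddle estimate applies, while intervals tagged in \<open>N\<close> are forced into an
  open set of measure less than \<open>\<delta>\<close>, where absolute continuity makes the total increment of \<open>f\<close> small
  and \<open>h\<close> contributes nothing.
\<close>

lemma has_integral_of_locally_absolutely_continuous: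
  fixes f h :: "real \<Rightarrow> real"
  assumes ac: "locally_absolutely_continuous f"
    and N: "negligible N"
    and deriv: "\<And>x. x \<notin> N \<Longrightarrow> (f has_real_derivative h x) (at x)"
    and h0: "\<And>x. x \<in> N \<Longrightarrow> h x = 0"
    and ab: "a < b"
  shows "(h has_integral (f b - f a)) {a..b}"
proof -
  have "(h has_integral (f b - f a)) (cbox a b)"
    unfolding has_integral
  proof (intro allI impI)
    fix e :: real assume e: "e > 0"
    obtain \<delta> where \<delta>: "\<delta> > 0" and acd: "\<And>(n::nat) (u::nat \<Rightarrow> real) v.
        (\<forall>i<n. a \<le> u i \<and> u i \<le> v i \<and> v i \<le> b) \<Longrightarrow>
        disjoint_family_on (\<lambda>i. {u i<..<v i}) {..<n} \<Longrightarrow> (\<Sum>i<n. v i - u i) < \<delta> \<Longrightarrow>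
        (\<Sum>i<n. \<bar>f (v i) - f (u i)\<bar>) < e / 2"
      using ac[unfolded locally_absolutely_continuous_def absolutely_continuous_on_interval_def,
          rule_format, of "e / 2" a b] e by auto
    have NL: "N \<in> null_sets lebesgue" using N by (simp add: negligible_iff_null_sets)
    obtain U where U: "open U" "N \<subseteq> U" "U - N \<in> lmeasurable" "emeasure lebesgue (U - N) < ennreal \<delta>"
      by (rule sets_lebesgue_outer_open[OF null_setsD2[OF NL] \<delta>])
    have emU: "emeasure lborel U < ennreal \<delta>"
    proof -
      have "emeasure lebesgue U \<le> emeasure lebesgue ((U - N) \<union> N)"
        using U NL by (intro emeasure_mono) auto
      also have "\<dots> = emeasure lebesgue (U - N)"
        using U NL by (intro emeasure_Un_null_set) auto
      finally show ?thesis using U by (simp add: order_le_less_trans)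
    qed
    have "\<exists>d. d > 0 \<and> (x \<in> N \<longrightarrow> ball x d \<subseteq> U) \<and> (x \<notin> N \<longrightarrow>
        (\<forall>y. \<bar>y - x\<bar> < d \<longrightarrow> \<bar>f y - f x - h x * (y - x)\<bar> \<le> e / (4 * (b - a)) * \<bar>y - x\<bar>))" for x
    proof (cases "x \<in> N")
      case True
      then obtain d where "d > 0" "ball x d \<subseteq> U" using U open_contains_ball by (metis subsetD)
      then show ?thesis using True by auto
    next
      case False
      have "(f has_derivative (*) (h x)) (at x)"
        using deriv[OF False] by (simp add: has_field_derivative_def)
      moreover have "e / (4 * (b - a)) > 0" using e ab by simp
      ultimately obtain d where "d > 0" "\<And>y. norm (y - x) < d \<Longrightarrow>
          norm (f y - f x - h x * (y - x)) \<le> e / (4 * (b - a)) * norm (y - x)"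
        unfolding has_derivative_at_alt by blast
      then show ?thesis using False by (intro exI[of _ d]) auto
    qed
    then have "\<exists>d. \<forall>x. d x > 0 \<and> (x \<in> N \<longrightarrow> ball x (d x) \<subseteq> U) \<and> (x \<notin> N \<longrightarrow>
        (\<forall>y. \<bar>y - x\<bar> < d x \<longrightarrow> \<bar>f y - f x - h x * (y - x)\<bar> \<le> e / (4 * (b - a)) * \<bar>y - x\<bar>))"
      by (rule allI[THEN choice])
    then obtain d where d0: "\<And>x. d x > 0"
      and dN: "\<And>x. x \<in> N \<Longrightarrow> ball x (d x) \<subseteq> U"
      and dD: "\<And>x y. x \<notin> N \<Longrightarrow> \<bar>y - x\<bar> < d x \<Longrightarrow>
          \<bar>f y - f x - h x * (y - x)\<bar> \<le> e / (4 * (b - a)) * \<bar>y - x\<bar>"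
      by blast
    define \<gamma> where "\<gamma> x = ball x (d x)" for x
    have g: "gauge \<gamma>" unfolding \<gamma>_def gauge_def using d0 by auto
    show "\<exists>\<gamma>. gauge \<gamma> \<and> (\<forall>\<D>. \<D> tagged_division_of cbox a b \<and> \<gamma> fine \<D> \<longrightarrow>
        norm ((\<Sum>(x, k)\<in>\<D>. Henstock_Kurzweil_Integration.content k *\<^sub>R h x) - (f b - f a)) < e)"
    proof (intro exI[of _ \<gamma>] conjI g allI impI, elim conjE)
      fix p assume p: "p tagged_division_of cbox a b" and fine: "\<gamma> fine p"
      have fin: "finite p" using p by (rule tagged_division_of_finite)
      have K: "\<exists>u v. K = {u..v} \<and> u \<le> x \<and> x \<le> v \<and> a \<le> u \<and> v \<le> b" if xK: "(x,K) \<in> p" for x K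
      proof -
        obtain u v where "K = cbox u v" using tagged_division_ofD(4)[OF p xK] by blast
        moreover have "x \<in> K" "K \<subseteq> cbox a b" using tagged_division_ofD(2,3)[OF p xK] by auto
        ultimately show ?thesis by (intro exI[of _ u] exI[of _ v]) auto
      qed
      define T where "T = (\<lambda>(x,K). f (Sup K) - f (Inf K) - h x * (Sup K - Inf K))"
      have *: "(\<Sum>(x, k)\<in>p. Henstock_Kurzweil_Integration.content k *\<^sub>R h x) - (f b - f a) = - (\<Sum>z\<in>p. T z)"
      proof -
        have "(\<Sum>z\<in>p. T z) = (\<Sum>(x,K)\<in>p. f (Sup K) - f (Inf K)) - (\<Sum>(x,K)\<in>p. h x * (Sup K - Inf K))"
          by (simp add: T_def sum_subtractf case_prod_unfold)
        also have "(\<Sum>(x,K)\<in>p. f (Sup K) - f (Inf K)) = f b - f a"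
          using additive_tagged_division_1[of a b p f] p ab by simp
        also have "(\<Sum>(x,K)\<in>p. h x * (Sup K - Inf K)) = (\<Sum>(x, k)\<in>p. Henstock_Kurzweil_Integration.content k *\<^sub>R h x)"
        proof (intro sum.cong refl, clarify)
          fix x K assume "(x,K) \<in> p"
          from K[OF this] obtain u v where "K = {u..v}" "u \<le> x" "x \<le> v" by blast
          then show "h x * (Sup K - Inf K) = Henstock_Kurzweil_Integration.content K *\<^sub>R h x" by simp
        qed
        finally show ?thesis by simp
      qed
      define q where "q = {z\<in>p. fst z \<in> N}"
      have q: "finite q" "q \<subseteq> p" using fin by (auto simp: q_def)
      have good: "(\<Sum>z\<in>p - q. \<bar>T z\<bar>) \<le> e / 4"
      proof -
        have "(\<Sum>z\<in>p - q. \<bar>T z\<bar>) \<le> (\<Sum>z\<in>p - q. e / (4 * (b - a)) * Henstock_Kurzweil_Integration.content (snd z))"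
        proof (rule sum_mono)
          fix z assume z: "z \<in> p - q"
          obtain x K where zz: "z = (x,K)" by force
          with z have xK: "(x,K) \<in> p" "x \<notin> N" by (auto simp: q_def)
          then obtain u v where uv: "K = {u..v}" "u \<le> x" "x \<le> v" using K by blast
          have "K \<subseteq> \<gamma> x" using fine xK(1) by (rule fineD)
          then have "u \<in> ball x (d x)" "v \<in> ball x (d x)" using uv by (auto simp: \<gamma>_def subset_iff)
          then have "\<bar>u - x\<bar> < d x" "\<bar>v - x\<bar> < d x" by (auto simp: dist_real_def)
          from this[THEN dD[OF xK(2)]]
          have 1: "\<bar>f u - f x - h x * (u - x)\<bar> \<le> e / (4 * (b - a)) * (x - u)"
            "\<bar>f v - f x - h x * (v - x)\<bar> \<le> e / (4 * (b - a)) * (v - x)" using uv by auto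
          have "T z = (f v - f x - h x * (v - x)) - (f u - f x - h x * (u - x))"
            using uv by (simp add: T_def zz algebra_simps)
          then have "\<bar>T z\<bar> \<le> e / (4 * (b - a)) * (v - x) + e / (4 * (b - a)) * (x - u)"
            using 1 by linarith
          also have "\<dots> = e / (4 * (b - a)) * (v - u)" by (simp only: distrib_left[symmetric]) simp
          finally show "\<bar>T z\<bar> \<le> e / (4 * (b - a)) * Henstock_Kurzweil_Integration.content (snd z)"
            using uv by (simp add: zz)
        qed
        also have "\<dots> \<le> (\<Sum>z\<in>p. e / (4 * (b - a)) * Henstock_Kurzweil_Integration.content (snd z))"
          using fin e ab by (intro sum_mono2) auto
        also have "\<dots> = e / (4 * (b - a)) * (\<Sum>(x,K)\<in>p. Henstock_Kurzweil_Integration.content K)"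
          by (simp add: sum_distrib_left case_prod_unfold)
        also have "\<dots> = e / 4" using additive_content_tagged_division[OF p] ab
          by (simp add: content_real divide_simps)
        finally show ?thesis .
      qed
      have bad: "(\<Sum>z\<in>q. \<bar>T z\<bar>) < e / 2"
      proof -
        obtain w where w: "bij_betw w {..<card q} q"
          using ex_bij_betw_nat_finite[OF q(1)] by (auto simp: atLeast0LessThan)
        define u v where "u i = Inf (snd (w i))" and "v i = Sup (snd (w i))" for i
        have wi: "w i \<in> q" if "i < card q" for i using w that by (auto simp: bij_betw_def)
        have uv: "snd (w i) = {u i..v i} \<and> u i \<le> fst (w i) \<and> fst (w i) \<le> v i \<and> a \<le> u i \<and> v i \<le> b"
          if "i < card q" for i
        proof -
          have "(fst (w i), snd (w i)) \<in> p" using wi[OF that] q by auto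
          from K[OF this] obtain u' v' where "snd (w i) = {u'..v'}" "u' \<le> fst (w i)" "fst (w i) \<le> v'"
            "a \<le> u'" "v' \<le> b" by blast
          then show ?thesis by (auto simp: u_def v_def)
        qed
        have dis: "disjoint_family_on (\<lambda>i. {u i<..<v i}) {..<card q}"
          unfolding disjoint_family_on_def
        proof (intro ballI impI)
          fix i j assume ij: "i \<in> {..<card q}" "j \<in> {..<card q}" "i \<noteq> j"
          have "w i \<noteq> w j" using ij w by (auto simp: bij_betw_def inj_on_def)
          moreover have "(fst (w i), snd (w i)) \<in> p" "(fst (w j), snd (w j)) \<in> p"
            using wi ij q by auto
          ultimately have "interior (snd (w i)) \<inter> interior (snd (w j)) = {}"
            by (intro tagged_division_ofD(5)[OF p, of "fst (w i)" "snd (w i)" "fst (w j)" "snd (w j)"])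
              (auto simp: prod_eq_iff)
          then show "{u i<..<v i} \<inter> {u j<..<v j} = {}" using uv ij by (simp add: interior_atLeastAtMost_real)
        qed
        have len: "(\<Sum>i<card q. v i - u i) < \<delta>"
        proof -
          have uvle: "u i \<le> v i" if "i < card q" for i using uv[OF that] by linarith
          have "ennreal (\<Sum>i<card q. v i - u i) = (\<Sum>i<card q. emeasure lborel {u i<..<v i})"
            using uvle by (subst sum_ennreal[symmetric]) (auto intro!: sum.cong)
          also have "\<dots> = emeasure lborel (\<Union>i<card q. {u i<..<v i})"
            using dis by (intro sum_emeasure) auto
          also have "\<dots> \<le> emeasure lborel U"
          proof (rule emeasure_mono)
            show "(\<Union>i<card q. {u i<..<v i}) \<subseteq> U"
            proof (rule UN_least)
              fix i assume i: "i \<in> {..<card q}"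
              have m: "(fst (w i), snd (w i)) \<in> p" and n: "fst (w i) \<in> N" using wi i by (auto simp: q_def)
              have "snd (w i) \<subseteq> \<gamma> (fst (w i))" using fine m by (rule fineD)
              also have "\<dots> \<subseteq> U" using dN[OF n] by (simp add: \<gamma>_def)
              finally show "{u i<..<v i} \<subseteq> U" using uv[of i] i greaterThanLessThan_subseteq_atLeastAtMost_iff by auto
            qed
          qed (use U in auto)
          also have "\<dots> < ennreal \<delta>" by fact
          finally show ?thesis using uvle by (subst (asm) ennreal_less_iff) (auto intro!: sum_nonneg)
        qed
        have "(\<Sum>z\<in>q. \<bar>T z\<bar>) = (\<Sum>i<card q. \<bar>T (w i)\<bar>)"
          using sum.reindex_bij_betw[OF w, of "\<lambda>z. \<bar>T z\<bar>"] by simp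
        also have "\<dots> = (\<Sum>i<card q. \<bar>f (v i) - f (u i)\<bar>)"
          using wi h0 by (intro sum.cong) (auto simp: T_def case_prod_unfold u_def v_def q_def)
        also have "\<dots> < e / 2"
        proof (intro acd dis len allI impI)
          fix i assume "i < card q"
          from uv[OF this] show "a \<le> u i \<and> u i \<le> v i \<and> v i \<le> b" by linarith
        qed
        finally show ?thesis .
      qed
      have "\<bar>\<Sum>z\<in>p. T z\<bar> \<le> (\<Sum>z\<in>p. \<bar>T z\<bar>)" by (rule sum_abs)
      also have "\<dots> = (\<Sum>z\<in>p - q. \<bar>T z\<bar>) + (\<Sum>z\<in>q. \<bar>T z\<bar>)"
        using fin q by (intro sum.subset_diff) auto
      also have "\<dots> < e" using good bad e by linarith
      finally show "norm ((\<Sum>(x, k)\<in>p. Henstock_Kurzweil_Integration.content k *\<^sub>R h x) - (f b - f a)) < e"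
        unfolding * by simp
    qed
  qed
  then show ?thesis by simp
qed

text \<open>
  By Cauchy-Schwarz the increment over \<open>[a, b]\<close> is at most the \<open>L^2\<close> norm of the derivative times
  \<open>sqrt (b - a)\<close>. The proof uses the pointwise bound
  \<open>\<bar>g\<bar> \<le> (l * g^2 + 1 / l) / 2\<close> with \<open>l = sqrt (b - a)\<close>, at the price of a slightly larger constant.
\<close>

lemma has_L2_derivative_half_Hoelder:
  assumes "has_L2_derivative f"
  obtains H where "H \<ge> 0" "\<And>s t. \<bar>f t - f s\<bar> \<le> H * sqrt \<bar>t - s\<bar>"
proof -
  obtain g where ac: "locally_absolutely_continuous f" and g: "g \<in> borel_measurable lborel"
    and D: "AE x in lborel. (f has_real_derivative g x) (at x)"
    and g2: "integrable lborel (\<lambda>x. (g x)\<^sup>2)"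
    using assms unfolding has_L2_derivative_def by blast
  define G where "G = (\<integral>x. (g x)\<^sup>2 \<partial>lborel)"
  have G0: "G \<ge> 0" by (simp add: G_def)
  obtain N where N: "{x. \<not> (f has_real_derivative g x) (at x)} \<subseteq> N" "N \<in> null_sets lborel"
    using D by (auto elim!: AE_E simp: null_sets_def)
  define h where "h x = (if x \<in> N then 0 else g x)" for x
  have negl: "negligible N" using N(2) by (simp add: negligible_iff_null_sets null_sets_completionI)
  have G2: "((\<lambda>x. (g x)\<^sup>2) has_integral G) UNIV"
    unfolding G_def by (rule has_integral_integral_lborel[OF g2])
  have le: "\<bar>f b - f a\<bar> \<le> (G + 1) / 2 * sqrt (b - a)" if ab: "a < b" for a b
  proof -
    define l where "l = sqrt (b - a)"
    have l: "l > 0" "l * l = b - a" using ab by (auto simp: l_def)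
    have hi: "(h has_integral (f b - f a)) {a..b}"
      by (rule has_integral_of_locally_absolutely_continuous[OF ac negl _ _ ab])
         (use N(1) in \<open>auto simp: h_def\<close>)
    have gi: "(\<lambda>x. (g x)\<^sup>2) integrable_on {a..b}"
      using G2 integrable_on_subinterval[of _ UNIV a b] by (auto simp: integrable_on_def)
    then obtain J where J: "((\<lambda>x. (g x)\<^sup>2) has_integral J) {a..b}" by (auto simp: integrable_on_def)
    have JG: "J \<le> G" by (rule has_integral_subset_le[OF _ J G2]) auto
    have k: "((\<lambda>x. l / 2 * (g x)\<^sup>2 + 1 / (2 * l)) has_integral (l / 2 * J + (b - a) / (2 * l))) {a..b}"
      using has_integral_add[OF has_integral_mult_right[OF J, of "l / 2"]
          has_integral_const_real[of "1 / (2*l)" a b]] ab by simp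
    have bnd: "\<bar>h x\<bar> \<le> l / 2 * (g x)\<^sup>2 + 1 / (2 * l)" for x
    proof -
      have "0 \<le> (l * \<bar>g x\<bar> - 1)\<^sup>2" by simp
      also have "\<dots> = l\<^sup>2 * (g x)\<^sup>2 - 2 * l * \<bar>g x\<bar> + 1" by (simp add: power2_diff power_mult_distrib)
      finally have "\<bar>g x\<bar> \<le> l / 2 * (g x)\<^sup>2 + 1 / (2 * l)"
        using l(1) by (simp add: field_simps power2_eq_square)
      then show ?thesis using l by (auto simp: h_def)
    qed
    have "f b - f a \<le> l / 2 * J + (b - a) / (2 * l)"
      by (rule has_integral_le[OF hi k]) (use bnd abs_le_D1 in blast)
    moreover have "- (f b - f a) \<le> l / 2 * J + (b - a) / (2 * l)"
      by (rule has_integral_le[OF has_integral_neg[OF hi] k]) (use bnd abs_le_D2 in blast)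
    ultimately have "\<bar>f b - f a\<bar> \<le> l / 2 * J + (b - a) / (2 * l)" by (rule abs_leI)
    also have "\<dots> = l / 2 * J + l / 2" using l(1) by (simp add: l(2)[symmetric])
    also have "\<dots> \<le> l / 2 * G + l / 2" using JG l by simp
    also have "\<dots> = (G + 1) / 2 * l" by (simp add: field_simps)
    finally show ?thesis by (simp add: l_def)
  qed
  show thesis
  proof (rule that[of "(G + 1) / 2"])
    show "\<bar>f t - f s\<bar> \<le> (G + 1) / 2 * sqrt \<bar>t - s\<bar>" for s t
      using le[of s t] le[of t s] by (cases s t rule: linorder_cases) (auto simp: abs_minus_commute)
  qed (use G0 in auto)
qed

section \<open>Exponential moments of Brownian increments\<close>

context prob_space
begin

lemma standard_brownian_motion_measurable:
  assumes "standard_brownian_motion B" "0 \<le> t"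
  shows "B t \<in> borel_measurable M"
  using assms by (simp add: standard_brownian_motion_def)

lemma standard_brownian_motion_continuous:
  assumes "standard_brownian_motion B" "\<omega> \<in> space M"
  shows "continuous_on {0..} (\<lambda>t. B t \<omega>)"
  using assms by (simp add: standard_brownian_motion_def)

lemma standard_brownian_motion_indep:
  assumes "standard_brownian_motion B" "0 \<le> t 0" "\<And>i. i < n \<Longrightarrow> t i < t (Suc i)"
  shows "indep_vars (\<lambda>_. borel) (\<lambda>i \<omega>. B (t (Suc i)) \<omega> - B (t i) \<omega>) {..<n}"
proof -
  have "i < j \<Longrightarrow> j \<le> n \<Longrightarrow> t i < t j" for i j
  proof (induction j)
    case (Suc j)
    then show ?case using assms(3)[of j] by (cases "i = j") auto
  qed simp
  then have "strict_mono_on {..n} t" by (auto simp: strict_mono_on_def)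
  then show ?thesis using assms unfolding standard_brownian_motion_def by blast
qed

text \<open>
  The factor \<open>c\<close> allows for a scaled, possibly reflected, Brownian motion: multiplying by its sign does not
  change the standard normal law.
\<close>

lemma normalized_increment:
  assumes "standard_brownian_motion B" "0 \<le> s" "s < t" "c \<noteq> 0"
  shows "distributed M lborel (\<lambda>\<omega>. c * (B t \<omega> - B s \<omega>) / (\<bar>c\<bar> * sqrt (t - s))) std_normal_density"
proof -
  have "distributed M lborel (\<lambda>\<omega>. B t \<omega> - B s \<omega>) (normal_density 0 (sqrt (t - s)))"
    using assms unfolding standard_brownian_motion_def by blast
  from normal_density_affine[OF this _ \<open>c \<noteq> 0\<close>, of 0] assms
  have "distributed M lborel (\<lambda>\<omega>. c * (B t \<omega> - B s \<omega>)) (normal_density 0 (\<bar>c\<bar> * sqrt (t - s)))"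
    by simp
  then show ?thesis
    using assms by (subst (asm) normal_standard_normal_convert) auto
qed

text \<open>
  Completing the square turns \<open>exp (\<plusminus>x)\<close> times the standard normal density into \<open>exp (1/2)\<close> times the
  normal density with mean \<open>\<plusminus>1\<close>.
\<close>

lemma std_normal_exp_abs_moment:
  assumes "distributed M lborel Z std_normal_density"
  shows "(\<integral>\<^sup>+\<omega>. ennreal (exp \<bar>Z \<omega>\<bar>) \<partial>M) \<le> ennreal (2 * exp (1/2))"
proof -
  have "(\<integral>\<^sup>+\<omega>. ennreal (exp \<bar>Z \<omega>\<bar>) \<partial>M) = (\<integral>\<^sup>+x. ennreal (std_normal_density x) * ennreal (exp \<bar>x\<bar>) \<partial>lborel)"
    by (rule distributed_nn_integral[OF assms, symmetric]) measurable
  also have "\<dots> \<le> (\<integral>\<^sup>+x. ennreal (exp (1/2)) * (ennreal (normal_density 1 1 x) + ennreal (normal_density (-1) 1 x)) \<partial>lborel)"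
  proof (rule nn_integral_mono)
    fix x :: real
    have e: "std_normal_density x * exp (s * x) = exp (1/2) * normal_density s 1 x" if "s\<^sup>2 = 1" for s :: real
    proof -
      have "- x\<^sup>2 / 2 + s * x = 1/2 + - (x - s)\<^sup>2 / 2"
        using that by (simp add: power2_diff field_simps)
      then have "exp (- x\<^sup>2 / 2) * exp (s * x) = exp (1/2) * exp (- (x - s)\<^sup>2 / 2)"
        by (simp only: exp_add[symmetric])
      then show ?thesis by (simp add: std_normal_density_def normal_density_def)
    qed
    have "exp \<bar>x\<bar> \<le> exp (1 * x) + exp (- 1 * x)" by (simp add: abs_if)
    then have "std_normal_density x * exp \<bar>x\<bar> \<le> std_normal_density x * (exp (1 * x) + exp (- 1 * x))"
      by (intro mult_left_mono) auto
    also have "\<dots> = exp (1/2) * (normal_density 1 1 x + normal_density (-1) 1 x)"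
      using e[of 1] e[of "-1"] by (simp add: distrib_left)
    finally show "ennreal (std_normal_density x) * ennreal (exp \<bar>x\<bar>)
        \<le> ennreal (exp (1/2)) * (ennreal (normal_density 1 1 x) + ennreal (normal_density (-1) 1 x))"
      by (simp add: ennreal_mult[symmetric] ennreal_plus[symmetric] del: ennreal_plus)
  qed
  also have "\<dots> = ennreal (exp (1/2)) * ((\<integral>\<^sup>+x. ennreal (normal_density 1 1 x) \<partial>lborel) + (\<integral>\<^sup>+x. ennreal (normal_density (-1) 1 x) \<partial>lborel))"
    by (subst nn_integral_cmult) (auto simp: nn_integral_add)
  also have "\<dots> = ennreal (2 * exp (1/2))"
  proof -
    have "(\<integral>\<^sup>+x. ennreal (normal_density m 1 x) \<partial>lborel) = 1" for m
      by (subst nn_integral_eq_integral) auto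
    then show ?thesis
      by (simp add: ennreal_mult[symmetric] ennreal_plus[symmetric] mult.commute
          del: ennreal_plus flip: ennreal_1 ennreal_numeral)
  qed
  finally show ?thesis .
qed

lemma Chernoff_sum_abs:
  fixes \<xi> :: "'i \<Rightarrow> 'a \<Rightarrow> real"
  assumes I: "finite I" and ind: "indep_vars (\<lambda>_. borel) \<xi> I"
    and mom: "\<And>i. i \<in> I \<Longrightarrow> (\<integral>\<^sup>+\<omega>. ennreal (exp \<bar>\<xi> i \<omega>\<bar>) \<partial>M) \<le> ennreal C" and C: "0 \<le> C"
  shows "prob {\<omega>\<in>space M. x \<le> (\<Sum>i\<in>I. \<bar>\<xi> i \<omega>\<bar>)} \<le> C ^ card I * exp (- x)"
proof -
  have m: "\<xi> i \<in> borel_measurable M" if "i \<in> I" for i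
    using ind that by (simp add: indep_vars_def)
  let ?A = "{\<omega>\<in>space M. x \<le> (\<Sum>i\<in>I. \<bar>\<xi> i \<omega>\<bar>)}"
  have "emeasure M ?A = (\<integral>\<^sup>+\<omega>. indicator ?A \<omega> \<partial>M)"
    using m by (subst nn_integral_indicator) auto
  also have "\<dots> \<le> (\<integral>\<^sup>+\<omega>. ennreal (exp (- x)) * (\<Prod>i\<in>I. ennreal (exp \<bar>\<xi> i \<omega>\<bar>)) \<partial>M)"
  proof (rule nn_integral_mono)
    fix \<omega>
    have "(\<Prod>i\<in>I. ennreal (exp \<bar>\<xi> i \<omega>\<bar>)) = ennreal (exp (\<Sum>i\<in>I. \<bar>\<xi> i \<omega>\<bar>))"
      using I by (simp add: prod_ennreal exp_sum)
    moreover have "1 \<le> exp (- x) * exp (\<Sum>i\<in>I. \<bar>\<xi> i \<omega>\<bar>)" if "\<omega> \<in> ?A"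
      using that by (simp add: exp_add[symmetric])
    ultimately show "indicator ?A \<omega> \<le> ennreal (exp (- x)) * (\<Prod>i\<in>I. ennreal (exp \<bar>\<xi> i \<omega>\<bar>))"
      by (auto simp: indicator_def ennreal_mult[symmetric] simp flip: ennreal_1)
  qed
  also have "\<dots> = ennreal (exp (- x)) * (\<integral>\<^sup>+\<omega>. (\<Prod>i\<in>I. ennreal (exp \<bar>\<xi> i \<omega>\<bar>)) \<partial>M)"
    using m by (intro nn_integral_cmult) (auto intro!: borel_measurable_prod_ennreal)
  also have "(\<integral>\<^sup>+\<omega>. (\<Prod>i\<in>I. ennreal (exp \<bar>\<xi> i \<omega>\<bar>)) \<partial>M) = (\<Prod>i\<in>I. \<integral>\<^sup>+\<omega>. ennreal (exp \<bar>\<xi> i \<omega>\<bar>) \<partial>M)"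
    by (intro indep_vars_nn_integral[OF I] indep_vars_compose2[OF ind]) auto
  also have "\<dots> \<le> (\<Prod>i\<in>I. ennreal C)" using I mom by (induction I rule: finite_induct) (auto intro!: mult_mono)
  also have "\<dots> = ennreal (C ^ card I)" using C by (simp add: ennreal_power)
  finally have "emeasure M ?A \<le> ennreal (exp (- x)) * ennreal (C ^ card I)" by (simp add: mult_left_mono)
  then have "ennreal (prob ?A) \<le> ennreal (C ^ card I * exp (- x))"
    using C by (simp add: ennreal_mult[symmetric] mult.commute emeasure_eq_measure)
  then show ?thesis using C by (simp add: ennreal_le_iff)
qed

lemma scaled_increment_exp_abs_moment:
  assumes B: "standard_brownian_motion B" "0 \<le> s" "s < t" and c: "c * sqrt (t - s) \<le> 1" "c > 0"
  shows "(\<integral>\<^sup>+\<omega>. ennreal (exp \<bar>c * (B t \<omega> - B s \<omega>)\<bar>) \<partial>M) \<le> ennreal (2 * exp (1/2))"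
proof -
  let ?Z = "\<lambda>\<omega>. 1 * (B t \<omega> - B s \<omega>) / (\<bar>1\<bar> * sqrt (t - s))"
  have "(\<integral>\<^sup>+\<omega>. ennreal (exp \<bar>c * (B t \<omega> - B s \<omega>)\<bar>) \<partial>M) \<le> (\<integral>\<^sup>+\<omega>. ennreal (exp \<bar>?Z \<omega>\<bar>) \<partial>M)"
  proof (intro nn_integral_mono ennreal_leI)
    fix \<omega>
    have "c \<le> 1 / sqrt (t - s)" using c B by (simp add: field_simps)
    then have "c * \<bar>B t \<omega> - B s \<omega>\<bar> \<le> 1 / sqrt (t - s) * \<bar>B t \<omega> - B s \<omega>\<bar>" by (intro mult_right_mono) auto
    then show "exp \<bar>c * (B t \<omega> - B s \<omega>)\<bar> \<le> exp \<bar>?Z \<omega>\<bar>"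
      using c B by (simp add: abs_mult)
  qed
  also have "\<dots> \<le> ennreal (2 * exp (1/2))"
    by (rule std_normal_exp_abs_moment[OF normalized_increment[OF B]]) simp
  finally show ?thesis .
qed

lemma increment_tail:
  assumes B: "standard_brownian_motion B" "0 \<le> s" "s < t"
  shows "prob {\<omega>\<in>space M. y * sqrt (t - s) \<le> \<bar>B t \<omega> - B s \<omega>\<bar>} \<le> 2 * exp (1/2) * exp (- y)"
proof -
  define c where "c = 1 / sqrt (t - s)"
  have c: "c > 0" "c * sqrt (t - s) \<le> 1" using B by (auto simp: c_def)
  define u where "u i = (if i = 0 then s else t)" for i :: nat
  let ?\<xi> = "\<lambda>i \<omega>. c * (B (u (Suc i)) \<omega> - B (u i) \<omega>)"
  have *: "{\<omega>\<in>space M. y * sqrt (t - s) \<le> \<bar>B t \<omega> - B s \<omega>\<bar>} = {\<omega>\<in>space M. y \<le> (\<Sum>i\<in>{..<1}. \<bar>?\<xi> i \<omega>\<bar>)}"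
    using B by (auto simp: c_def u_def abs_mult field_simps)
  have ind: "indep_vars (\<lambda>_. borel) ?\<xi> {..<1}"
    by (rule indep_vars_compose2[OF standard_brownian_motion_indep[where t=u, OF B(1)]])
       (use B in \<open>auto simp: u_def\<close>)
  have mom: "(\<integral>\<^sup>+\<omega>. ennreal (exp \<bar>?\<xi> i \<omega>\<bar>) \<partial>M) \<le> ennreal (2 * exp (1/2))" if "i \<in> {..<1}" for i
    using that scaled_increment_exp_abs_moment[OF B c(2,1)] by (simp add: u_def)
  show ?thesis unfolding * using Chernoff_sum_abs[OF _ ind mom, of y] by simp
qed

end

text \<open>
  Halving at each step keeps the sum of the \<open>\<bar>Y i\<bar>\<close> comparable to the sum of the innovations \<open>\<bar>\<xi> i\<bar>\<close>.
  The induction needs the extra term \<open>\<bar>Y l\<bar>\<close>, which pays for the next step.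
\<close>

lemma sum_abs_autoregression:
  fixes Y \<xi> :: "nat \<Rightarrow> real"
  assumes "Y 0 = \<xi> 0" "\<And>i. i < m \<Longrightarrow> Y (Suc i) = Y i / 2 + \<xi> (Suc i)"
  shows "(\<Sum>i\<le>m. \<bar>Y i\<bar>) \<le> 2 * (\<Sum>i\<le>m. \<bar>\<xi> i\<bar>)"
proof -
  have "(\<Sum>i\<le>l. \<bar>Y i\<bar>) + \<bar>Y l\<bar> \<le> 2 * (\<Sum>i\<le>l. \<bar>\<xi> i\<bar>)" if "l \<le> m" for l
    using that
  proof (induction l)
    case 0
    then show ?case using assms by simp
  next
    case (Suc l)
    have "\<bar>Y (Suc l)\<bar> \<le> \<bar>Y l\<bar> / 2 + \<bar>\<xi> (Suc l)\<bar>"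
      using assms(2)[of l] Suc.prems by simp
    then show ?case using Suc by simp
  qed
  from this[of m] show ?thesis by simp
qed

context prob_space
begin

text \<open>
  Rescaled by \<open>2^k\<close>, the increments from \<open>s\<close> to \<open>s + 4^-k\<close> form, as \<open>k\<close> decreases, an autoregressive
  sequence \<open>Y\<close> with factor one half and independent Gaussian innovations. If all of them are at least \<open>K\<close>,
  the innovations must add up to \<open>K / 2\<close> per scale, and the Chernoff bound makes this exponentially
  unlikely, with a base as small as desired for large \<open>K\<close>.
\<close>

lemma all_scales_large_prob:
  assumes B: "standard_brownian_motion B" and s: "0 \<le> s" and kn: "k0 \<le> n"
  shows "prob {\<omega>\<in>space M. \<forall>k\<in>{k0..n}. K * (1/2)^k \<le> \<bar>B (s + (1/4)^k) \<omega> - B s \<omega>\<bar>}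
    \<le> (2 * exp (1/2) * exp (- K / 2)) ^ (n - k0 + 1)"
    (is "prob ?A \<le> _")
proof -
  define N where "N = n - k0"
  define t where "t i = (if i = 0 then s else s + (1/4::real) ^ (n - (i - 1)))" for i
  define \<xi> where "\<xi> i \<omega> = 2 ^ (n - i) * (B (t (Suc i)) \<omega> - B (t i) \<omega>)" for i \<omega>
  define Y where "Y i \<omega> = 2 ^ (n - i) * (B (t (Suc i)) \<omega> - B s \<omega>)" for i \<omega>
  have tS: "t (Suc i) = s + (1/4) ^ (n - i)" for i by (simp add: t_def)
  \<comment> \<open>The times start at s and then run through s + 4^-k for k = n, n - 1, ..., k0.\<close>
  have nSuc: "n - i = Suc (n - Suc i)" if "i < N" for i using that by (auto simp: N_def)
  have tm: "t i < t (Suc i)" if "i < Suc N" for i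
  proof (cases i)
    case (Suc j)
    then show ?thesis using that nSuc[of j] by (simp add: t_def)
  qed (simp add: t_def)
  have t0: "0 \<le> t i" for i using s by (simp add: t_def)
  have mB: "B (t i) \<in> borel_measurable M" for i
    by (rule standard_brownian_motion_measurable[OF B t0])
  have ind: "indep_vars (\<lambda>_. borel) \<xi> {..<Suc N}"
    unfolding \<xi>_def
    by (rule indep_vars_compose2[OF standard_brownian_motion_indep[where t=t, OF B t0 tm]]) auto
  have mom: "(\<integral>\<^sup>+\<omega>. ennreal (exp \<bar>\<xi> i \<omega>\<bar>) \<partial>M) \<le> ennreal (2 * exp (1/2))" if "i \<in> {..<Suc N}" for i
    unfolding \<xi>_def
  proof (rule scaled_increment_exp_abs_moment[OF B t0 tm])
    have "s \<le> t i" by (simp add: t_def)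
    then have "sqrt (t (Suc i) - t i) \<le> sqrt ((1/4) ^ (n - i))" by (simp add: tS)
    also have "\<dots> = (1/2) ^ (n - i)" by (simp add: real_sqrt_power real_sqrt_divide)
    finally have "2 ^ (n - i) * sqrt (t (Suc i) - t i) \<le> 2 ^ (n - i) * (1/2) ^ (n - i)"
      by (intro mult_left_mono) auto
    then show "2 ^ (n - i) * sqrt (t (Suc i) - t i) \<le> 1" by (simp add: power_mult_distrib[symmetric])
  qed (use that in auto)
  have "?A \<subseteq> {\<omega>\<in>space M. K / 2 * (N + 1) \<le> (\<Sum>i\<in>{..<Suc N}. \<bar>\<xi> i \<omega>\<bar>)}"
  proof safe
    fix \<omega> assume "\<omega> \<in> space M" and A: "\<forall>k\<in>{k0..n}. K * (1/2)^k \<le> \<bar>B (s + (1/4)^k) \<omega> - B s \<omega>\<bar>"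
    have "(\<Sum>i\<le>N. \<bar>Y i \<omega>\<bar>) \<le> 2 * (\<Sum>i\<le>N. \<bar>\<xi> i \<omega>\<bar>)"
    proof (rule sum_abs_autoregression)
      show "Y 0 \<omega> = \<xi> 0 \<omega>" by (simp add: Y_def \<xi>_def t_def)
      show "Y (Suc i) \<omega> = Y i \<omega> / 2 + \<xi> (Suc i) \<omega>" if "i < N" for i
        using nSuc[OF that] by (simp add: Y_def \<xi>_def field_simps)
    qed
    moreover have "K \<le> \<bar>Y i \<omega>\<bar>" if "i \<le> N" for i
    proof -
      have "n - i \<in> {k0..n}" using that kn by (auto simp: N_def)
      with A have "K * (1/2)^(n - i) \<le> \<bar>B (t (Suc i)) \<omega> - B s \<omega>\<bar>" by (simp add: tS)
      then have "2 ^ (n - i) * (K * (1/2)^(n - i)) \<le> 2 ^ (n - i) * \<bar>B (t (Suc i)) \<omega> - B s \<omega>\<bar>"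
        by (intro mult_left_mono) auto
      then show ?thesis by (simp add: Y_def abs_mult power_one_over)
    qed
    then have "(\<Sum>i\<le>N. K) \<le> (\<Sum>i\<le>N. \<bar>Y i \<omega>\<bar>)" by (intro sum_mono) auto
    ultimately show "K / 2 * (N + 1) \<le> (\<Sum>i\<in>{..<Suc N}. \<bar>\<xi> i \<omega>\<bar>)"
      by (simp add: lessThan_Suc_atMost algebra_simps)
  qed
  then have "prob ?A \<le> prob {\<omega>\<in>space M. K / 2 * (N + 1) \<le> (\<Sum>i\<in>{..<Suc N}. \<bar>\<xi> i \<omega>\<bar>)}"
    using mB by (intro finite_measure_mono) (auto simp: \<xi>_def)
  also have "\<dots> \<le> (2 * exp (1/2)) ^ card {..<Suc N} * exp (- (K / 2 * (N + 1)))"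
    by (rule Chernoff_sum_abs[OF _ ind mom]) auto
  also have "exp (- (K / 2 * (N + 1))) = exp (- K / 2) ^ (N + 1)"
    by (subst exp_of_nat_mult[symmetric]) (simp add: field_simps)
  finally show ?thesis by (simp only: power_mult_distrib N_def card_lessThan Suc_eq_plus1)
qed

end

section \<open>Small increments at every time\<close>

text \<open>
  Left neighbours on grids of mesh \<open>16^-n\<close>. The base is a power of \<open>4\<close>, so that a step \<open>4^-k\<close>, for \<open>k \<le> n\<close>,
  maps the grid to itself (\<open>grid_floor_add\<close>); an increment over \<open>16^-n\<close> has standard deviation
  \<open>4^-n\<close>, so that the bound \<open>2^-n\<close> holds for all increments between neighbouring grid points, with
  plenty of room, once \<open>n\<close> is large.
\<close>

definition grid_floor :: "nat \<Rightarrow> real \<Rightarrow> nat" where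
  "grid_floor n t = nat \<lfloor>16 ^ n * t\<rfloor>"

lemma grid_floor_bounds:
  assumes "0 \<le> t"
  shows "real (grid_floor n t) / 16 ^ n \<le> t" "t < (real (grid_floor n t) + 1) / 16 ^ n"
proof -
  have "real (grid_floor n t) = of_int \<lfloor>16 ^ n * t\<rfloor>" using assms by (simp add: grid_floor_def)
  then have "real (grid_floor n t) \<le> 16 ^ n * t" "16 ^ n * t < real (grid_floor n t) + 1" by linarith+
  then show "real (grid_floor n t) / 16 ^ n \<le> t" "t < (real (grid_floor n t) + 1) / 16 ^ n"
    by (simp_all add: field_simps)
qed

lemma grid_floor_less:
  assumes "0 \<le> t" "t < real T"
  shows "grid_floor n t < T * 16 ^ n"
proof -
  have "real (grid_floor n t) \<le> 16 ^ n * t"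
    using grid_floor_bounds(1)[OF assms(1), of n] by (simp add: field_simps)
  also have "\<dots> < 16 ^ n * real T" using assms by simp
  also have "\<dots> = real (T * 16 ^ n)" by simp
  finally show ?thesis by (simp only: of_nat_less_iff)
qed

lemma grid_floor_Suc:
  assumes "0 \<le> t"
  obtains i where "i \<le> 15" "grid_floor (Suc n) t = 16 * grid_floor n t + i"
proof -
  define x where "x = 16 ^ n * t"
  have "0 \<le> x" using assms by (simp add: x_def)
  then have "16 * \<lfloor>x\<rfloor> \<le> \<lfloor>16 * x\<rfloor>" "\<lfloor>16 * x\<rfloor> < 16 * \<lfloor>x\<rfloor> + 16" "0 \<le> \<lfloor>x\<rfloor>"
    by linarith+
  then have "16 * nat \<lfloor>x\<rfloor> \<le> nat \<lfloor>16 * x\<rfloor> \<and> nat \<lfloor>16 * x\<rfloor> < 16 * nat \<lfloor>x\<rfloor> + 16" by linarith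
  moreover have "grid_floor (Suc n) t = nat \<lfloor>16 * x\<rfloor>" "grid_floor n t = nat \<lfloor>x\<rfloor>"
    by (simp_all add: grid_floor_def x_def algebra_simps)
  ultimately show thesis by (intro that[of "nat \<lfloor>16 * x\<rfloor> - 16 * nat \<lfloor>x\<rfloor>"]) auto
qed

lemma grid_floor_add:
  assumes "0 \<le> t" "k \<le> n"
  shows "real (grid_floor n (t + (1/4) ^ k)) / 16 ^ n = real (grid_floor n t) / 16 ^ n + (1/4) ^ k"
proof -
  have e: "(16::real) ^ n * (1/4) ^ k = real (4 ^ (2 * n - k))"
  proof -
    have "(16::real) ^ n = 4 ^ (2 * n - k) * 4 ^ k"
      using assms by (simp add: power_mult power_add[symmetric])
    then show ?thesis by (simp add: power_one_over)
  qed
  have "16 ^ n * (t + (1/4) ^ k) = 16 ^ n * t + of_int (int (4 ^ (2 * n - k)))"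
    using e by (simp add: distrib_left)
  then have "\<lfloor>16 ^ n * (t + (1/4) ^ k)\<rfloor> = \<lfloor>16 ^ n * t\<rfloor> + int (4 ^ (2 * n - k))"
    by (metis floor_add_int)
  moreover have "0 \<le> 16 ^ n * t" using assms(1) by simp
  then have "0 \<le> \<lfloor>16 ^ n * t\<rfloor>" by linarith
  moreover have "nat (a + int b) = nat a + b" if "0 \<le> a" for a b using that by linarith
  ultimately have "grid_floor n (t + (1/4) ^ k) = grid_floor n t + 4 ^ (2 * n - k)"
    unfolding grid_floor_def by metis
  then show ?thesis using e by (simp add: field_simps)
qed

lemma grid_floor_tendsto:
  assumes "0 \<le> t"
  shows "(\<lambda>n. real (grid_floor n t) / 16 ^ n) \<longlonglongrightarrow> t"
proof (rule real_tendsto_sandwich)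
  show "\<forall>\<^sub>F n in sequentially. t - (1/16) ^ n \<le> real (grid_floor n t) / 16 ^ n"
  proof (intro always_eventually allI)
    fix n
    have "t < real (grid_floor n t) / 16 ^ n + (1/16) ^ n"
      using grid_floor_bounds(2)[OF assms, of n] by (simp only: add_divide_distrib power_one_over)
    then show "t - (1/16) ^ n \<le> real (grid_floor n t) / 16 ^ n" by linarith
  qed
  show "\<forall>\<^sub>F n in sequentially. real (grid_floor n t) / 16 ^ n \<le> t"
    using grid_floor_bounds(1)[OF assms] by simp
  show "(\<lambda>n. t - (1/16) ^ n) \<longlonglongrightarrow> t"
    using tendsto_diff[OF tendsto_const LIMSEQ_realpow_zero[of "1/16"]] by simp
qed simp

text \<open>
  Passing from the grid of level \<open>m\<close> to that of level \<open>m + 1\<close> takes at most \<open>15\<close> steps of size at most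
  \<open>2^-(m+1)\<close>; summing over all \<open>m \<ge> n\<close> gives the bound, and continuity lets the grid points reach \<open>t\<close>.
\<close>

lemma chaining_oscillation:
  fixes f :: "real \<Rightarrow> real"
  assumes cont: "continuous_on {0..} f" and t: "0 \<le> t" "t < real T"
    and inc: "\<And>m j. n \<le> m \<Longrightarrow> j < T * 16 ^ m \<Longrightarrow> \<bar>f (real (Suc j) / 16 ^ m) - f (real j / 16 ^ m)\<bar> \<le> (1/2) ^ m"
  shows "\<bar>f t - f (real (grid_floor n t) / 16 ^ n)\<bar> \<le> 15 * (1/2) ^ n"
proof -
  define p where "p m = real (grid_floor m t) / 16 ^ m" for m
  have step: "\<bar>f (p (Suc m)) - f (p m)\<bar> \<le> 15 * (1/2) ^ Suc m" if nm: "n \<le> m" for m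
  proof -
    obtain i where i: "i \<le> 15" "grid_floor (Suc m) t = 16 * grid_floor m t + i"
      by (rule grid_floor_Suc[OF t(1)])
    let ?b = "16 * grid_floor m t"
    define g where "g l = f (real (?b + l) / 16 ^ Suc m)" for l
    have lt: "?b + i < T * 16 ^ Suc m" using grid_floor_less[OF t, of "Suc m"] i by simp
    have "\<bar>g l - g 0\<bar> \<le> real l * (1/2) ^ Suc m" if "l \<le> i" for l
      using that
    proof (induction l)
      case (Suc l)
      have "\<bar>g (Suc l) - g l\<bar> \<le> (1/2) ^ Suc m"
        using inc[of "Suc m" "?b + l"] nm lt Suc.prems by (simp only: g_def add_Suc_right)
      moreover have "real (Suc l) * (1/2) ^ Suc m = real l * (1/2) ^ Suc m + (1/2) ^ Suc m"
        by (simp only: of_nat_Suc distrib_right mult_1_left)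
      ultimately show ?case using Suc.IH Suc.prems by linarith
    qed simp
    from this[of i] have "\<bar>g i - g 0\<bar> \<le> real i * (1/2) ^ Suc m" by simp
    also have "\<dots> \<le> 15 * (1/2) ^ Suc m" using i by (intro mult_right_mono) auto
    finally show ?thesis using i(2) by (simp add: p_def g_def)
  qed
  have all: "\<bar>f (p (n + r)) - f (p n)\<bar> \<le> 15 * (1/2) ^ n - 15 * (1/2) ^ (n + r)" for r
  proof (induction r)
    case (Suc r)
    then show ?case using step[of "n + r"] unfolding add_Suc_right power_Suc by linarith
  qed simp
  have "(\<lambda>r. p (n + r)) \<longlonglongrightarrow> t"
    using LIMSEQ_ignore_initial_segment[OF grid_floor_tendsto[OF t(1)], of n]
    by (simp add: p_def add.commute)
  moreover have "p m \<in> {0..}" for m by (simp add: p_def)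
  ultimately have "(\<lambda>r. f (p (n + r))) \<longlonglongrightarrow> f t"
    using cont t(1) by (intro continuous_on_tendsto_compose[OF cont]) auto
  then have "(\<lambda>r. \<bar>f (p (n + r)) - f (p n)\<bar>) \<longlonglongrightarrow> \<bar>f t - f (p n)\<bar>"
    by (intro tendsto_intros)
  moreover have "\<bar>f (p (n + r)) - f (p n)\<bar> \<le> 15 * (1/2) ^ n" for r
    using all[of r] by (rule order_trans) simp
  ultimately have "\<bar>f t - f (p n)\<bar> \<le> 15 * (1/2) ^ n"
    by (intro LIMSEQ_le_const2) auto
  then show ?thesis by (simp add: p_def)
qed

lemma exp_ge_power: "x ^ n / fact n \<le> exp x" if "0 \<le> x" for x :: real
proof -
  have "x ^ n / fact n = (\<Sum>k\<in>{n}. x ^ k /\<^sub>R fact k)" by (simp add: divide_inverse mult.commute)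
  also have "\<dots> \<le> (\<Sum>k. x ^ k /\<^sub>R fact k)"
    using that by (intro sum_le_suminf summable_exp_generic) auto
  finally show ?thesis by (simp add: exp_def)
qed

text \<open>
  A Gaussian tail estimate at distance \<open>2^m\<close> has to beat the \<open>16^m\<close> grid points summably, hence the
  comparison with \<open>32^-m\<close>.
\<close>

lemma exp_neg_power2_le: "exp (- (2 ^ m)) \<le> 120 * (1/32 :: real) ^ m"
proof -
  have f: "fact 5 = (120::real)" by (simp add: fact_numeral)
  have p: "((2::real) ^ m) ^ 5 = (2 ^ 5) ^ m" by (metis power_mult mult.commute)
  have n: "(2::real) ^ 5 = 32" by simp
  have "0 \<le> (2::real) ^ m" by simp
  from exp_ge_power[OF this, of 5] have le: "32 ^ m / 120 \<le> exp (2 ^ m :: real)"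
    unfolding f p n .
  have "exp (- (2 ^ m)) = inverse (exp (2 ^ m :: real))" by (rule exp_minus)
  also have "\<dots> \<le> inverse (32 ^ m / 120)" by (rule le_imp_inverse_le[OF le]) simp
  also have "\<dots> = 120 * (1/32) ^ m" by (simp only: power_one_over inverse_divide)
  finally show ?thesis .
qed

context prob_space
begin

lemma eventually_small_grid_increments:
  assumes B: "standard_brownian_motion B"
  shows "AE \<omega> in M. \<exists>n0. \<forall>m\<ge>n0. \<forall>j<T * 16 ^ m.
    \<bar>B (real (Suc j) / 16 ^ m) \<omega> - B (real j / 16 ^ m) \<omega>\<bar> \<le> (1/2) ^ m"
proof -
  define C where "C = 2 * exp (1/2 :: real)"
  have C0: "0 \<le> C" by (simp add: C_def)
  define E where "E m j = {\<omega>\<in>space M. (1/2) ^ m \<le> \<bar>B (real (Suc j) / 16 ^ m) \<omega> - B (real j / 16 ^ m) \<omega>\<bar>}"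
    for m j :: nat
  have E: "E m j \<in> events" for m j
    using standard_brownian_motion_measurable[OF B] unfolding E_def by measurable
  have pE: "prob (E m j) \<le> C * 120 * (1/32) ^ m" for m j
  proof -
    have "real (Suc j) / 16 ^ m - real j / 16 ^ m = (1/16) ^ m"
      by (simp add: diff_divide_distrib[symmetric] power_one_over)
    then have sq: "sqrt (real (Suc j) / 16 ^ m - real j / 16 ^ m) = (1/4) ^ m"
      by (simp add: real_sqrt_power real_sqrt_divide)
    have "2 ^ m * (1/4::real) ^ m = (1/2) ^ m" by (simp add: power_mult_distrib[symmetric])
    then have "prob (E m j) \<le> C * exp (- (2 ^ m))"
      using increment_tail[OF B, of "real j / 16 ^ m" "real (Suc j) / 16 ^ m" "2 ^ m"] sq
      by (simp add: E_def C_def divide_strict_right_mono)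
    also have "\<dots> \<le> C * (120 * (1/32) ^ m)"
      using exp_neg_power2_le C0 by (rule mult_left_mono)
    finally show ?thesis by (simp only: mult.assoc)
  qed
  have "AE \<omega> in M. \<forall>\<^sub>F m in sequentially. \<omega> \<in> space M - (\<Union>j<T * 16 ^ m. E m j)"
  proof (rule borel_cantelli_AE1)
    show "(\<Union>j<T * 16 ^ m. E m j) \<in> events" for m using E by auto
    have "prob (\<Union>j<T * 16 ^ m. E m j) \<le> T * C * 120 * (1/2) ^ m" for m
    proof -
      have "prob (\<Union>j<T * 16 ^ m. E m j) \<le> (\<Sum>j<T * 16 ^ m. prob (E m j))"
        using E by (intro finite_measure_subadditive_finite) auto
      also have "\<dots> \<le> (\<Sum>j<T * 16 ^ m. C * 120 * (1/32) ^ m)" by (intro sum_mono pE)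
      also have "\<dots> = T * C * 120 * (16 ^ m * (1/32) ^ m)" by simp
      also have "16 ^ m * (1/32) ^ m = (1/2 :: real) ^ m" by (simp add: power_mult_distrib[symmetric])
      finally show ?thesis .
    qed
    then show "summable (\<lambda>m. prob (\<Union>j<T * 16 ^ m. E m j))"
      by (intro summable_comparison_test'[where N=0, OF summable_mult[OF summable_geometric[of "1/2"], of "T * C * 120"]]) auto
  qed (simp add: less_top[symmetric])
  then show ?thesis
  proof (rule AE_mp, intro AE_I2 impI)
    fix \<omega> assume "\<omega> \<in> space M" "\<forall>\<^sub>F m in sequentially. \<omega> \<in> space M - (\<Union>j<T * 16 ^ m. E m j)"
    then obtain n0 where n0: "\<And>m j. n0 \<le> m \<Longrightarrow> j < T * 16 ^ m \<Longrightarrow> \<omega> \<notin> E m j"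
      unfolding eventually_sequentially by blast
    show "\<exists>n0. \<forall>m\<ge>n0. \<forall>j<T * 16 ^ m.
        \<bar>B (real (Suc j) / 16 ^ m) \<omega> - B (real j / 16 ^ m) \<omega>\<bar> \<le> (1/2) ^ m"
    proof (intro exI[of _ n0] allI impI)
      fix m j assume "n0 \<le> m" "j < T * 16 ^ m"
      from n0[OF this] \<open>\<omega> \<in> space M\<close>
      have "\<not> (1/2) ^ m \<le> \<bar>B (real (Suc j) / 16 ^ m) \<omega> - B (real j / 16 ^ m) \<omega>\<bar>"
        unfolding E_def by blast
      then show "\<bar>B (real (Suc j) / 16 ^ m) \<omega> - B (real j / 16 ^ m) \<omega>\<bar> \<le> (1/2) ^ m"
        by (simp only: not_le less_imp_le)
    qed
  qed
qed

text \<open>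
  The constant \<open>13\<close> makes the base in \<open>all_scales_large_prob\<close> at most \<open>1/32\<close>, so that the union bound over
  \<open>16^n\<close> grid points is summable in \<open>n\<close>.
\<close>

lemma eventually_no_grid_point_with_large_scales:
  assumes B: "standard_brownian_motion B"
  shows "AE \<omega> in M. \<exists>n0. \<forall>n\<ge>n0. \<forall>j<T * 16 ^ n. \<exists>k\<in>{k0..n}.
    \<bar>B (real j / 16 ^ n + (1/4) ^ k) \<omega> - B (real j / 16 ^ n) \<omega>\<bar> < 13 * (1/2) ^ k"
proof -
  define E where "E n j = {\<omega>\<in>space M. \<forall>k\<in>{k0..n}. 13 * (1/2) ^ k \<le> \<bar>B (real j / 16 ^ n + (1/4) ^ k) \<omega> - B (real j / 16 ^ n) \<omega>\<bar>}"
    for n j :: nat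
  have E: "E n j \<in> events" for n j
    using standard_brownian_motion_measurable[OF B] unfolding E_def by measurable
  have c: "2 * exp (1/2) * exp (- 13/2) \<le> (1/32 :: real)"
  proof -
    have "(1 + 1) ^ 6 \<le> exp (1::real) ^ 6" by (intro power_mono exp_ge_add_one_self) auto
    then have "64 \<le> exp (6 :: real)" by (simp add: exp_of_nat_mult[symmetric])
    then have "inverse (exp 6) \<le> inverse (64 :: real)" by (rule le_imp_inverse_le) simp
    moreover have "exp (1/2) * exp (- 13/2 :: real) = inverse (exp 6)"
      by (simp add: exp_add[symmetric] exp_minus[symmetric])
    ultimately show ?thesis by simp
  qed
  have pE: "prob (E n j) \<le> 32 ^ k0 * (1/32) ^ n" if "k0 \<le> n" for n j
  proof -
    have "prob (E n j) \<le> (2 * exp (1/2) * exp (- 13/2)) ^ (n - k0 + 1)"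
      unfolding E_def by (rule all_scales_large_prob[OF B _ that]) simp
    also have "\<dots> \<le> (1/32) ^ (n - k0 + 1)" using c by (intro power_mono) auto
    also have "\<dots> \<le> (1/32) ^ (n - k0)" by simp
    also have "\<dots> = 32 ^ k0 * (1/32) ^ n" using that by (simp add: power_diff power_one_over)
    finally show ?thesis .
  qed
  have "AE \<omega> in M. \<forall>\<^sub>F n in sequentially. \<omega> \<in> space M - (\<Union>j<T * 16 ^ n. E n j)"
  proof (rule borel_cantelli_AE1)
    show "(\<Union>j<T * 16 ^ n. E n j) \<in> events" for n using E by auto
    have "prob (\<Union>j<T * 16 ^ n. E n j) \<le> T * 32 ^ k0 * (1/2) ^ n" if n: "k0 \<le> n" for n
    proof -
      have "prob (\<Union>j<T * 16 ^ n. E n j) \<le> (\<Sum>j<T * 16 ^ n. prob (E n j))"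
        using E by (intro finite_measure_subadditive_finite) auto
      also have "\<dots> \<le> (\<Sum>j<T * 16 ^ n. 32 ^ k0 * (1/32) ^ n)" by (intro sum_mono pE n)
      also have "\<dots> = T * 32 ^ k0 * (16 ^ n * (1/32) ^ n)" by simp
      also have "16 ^ n * (1/32) ^ n = (1/2 :: real) ^ n" by (simp add: power_mult_distrib[symmetric])
      finally show ?thesis .
    qed
    then show "summable (\<lambda>n. prob (\<Union>j<T * 16 ^ n. E n j))"
      by (intro summable_comparison_test'[where N=k0, OF summable_mult[OF summable_geometric[of "1/2"], of "T * 32 ^ k0"]]) auto
  qed (simp add: less_top[symmetric])
  then show ?thesis
  proof (rule AE_mp, intro AE_I2 impI)
    fix \<omega> assume "\<omega> \<in> space M" "\<forall>\<^sub>F n in sequentially. \<omega> \<in> space M - (\<Union>j<T * 16 ^ n. E n j)"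
    then obtain n0 where n0: "\<And>n j. n0 \<le> n \<Longrightarrow> j < T * 16 ^ n \<Longrightarrow> \<omega> \<notin> E n j"
      unfolding eventually_sequentially by blast
    show "\<exists>n0. \<forall>n\<ge>n0. \<forall>j<T * 16 ^ n. \<exists>k\<in>{k0..n}.
        \<bar>B (real j / 16 ^ n + (1/4) ^ k) \<omega> - B (real j / 16 ^ n) \<omega>\<bar> < 13 * (1/2) ^ k"
    proof (intro exI[of _ n0] allI impI)
      fix n j assume "n0 \<le> n" "j < T * 16 ^ n"
      from n0[OF this] \<open>\<omega> \<in> space M\<close> show "\<exists>k\<in>{k0..n}.
        \<bar>B (real j / 16 ^ n + (1/4) ^ k) \<omega> - B (real j / 16 ^ n) \<omega>\<bar> < 13 * (1/2) ^ k"
        by (simp only: E_def mem_Collect_eq not_le[symmetric]) blast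
    qed
  qed
qed

end

lemma abs_diff_perturb:
  fixes a b a' b' e h :: real
  assumes "\<bar>a - a'\<bar> \<le> 15 * e" "\<bar>b - b'\<bar> \<le> 15 * e" "\<bar>a' - b'\<bar> < 13 * h" "e \<le> h"
  shows "\<bar>a - b\<bar> < 43 * h"
  using assms by linarith

text \<open>
  The left neighbour of \<open>t\<close> on a fine grid has a good scale \<open>k \<le> n\<close>. Replacing it by \<open>t\<close> costs an
  oscillation of \<open>15 * 2^-n \<le> 15 * 2^-k\<close> at either end of the increment, so \<open>13\<close> grows to
  \<open>13 + 15 + 15 = 43\<close>.
\<close>

lemma infinitely_many_small_increments_pathwise:
  fixes f :: "real \<Rightarrow> real"
  assumes cont: "continuous_on {0..} f"
    and large: "\<And>T k0. \<exists>n0. \<forall>n\<ge>n0. \<forall>j<T * 16 ^ n. \<exists>k\<in>{k0..n}.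
      \<bar>f (real j / 16 ^ n + (1/4) ^ k) - f (real j / 16 ^ n)\<bar> < 13 * (1/2) ^ k"
    and small: "\<And>T. \<exists>n0. \<forall>m\<ge>n0. \<forall>j<T * 16 ^ m.
      \<bar>f (real (Suc j) / 16 ^ m) - f (real j / 16 ^ m)\<bar> \<le> (1/2) ^ m"
    and t: "0 \<le> t"
  shows "\<exists>\<^sub>\<infinity>k. \<bar>f (t + (1/4) ^ k) - f t\<bar> < 43 * (1/2) ^ k"
  unfolding INFM_nat_le
proof
  fix k0
  obtain T where T: "t < real T" using reals_Archimedean2 by blast
  from large[rule_format, of T k0] obtain n1 where n1: "\<And>n j. n1 \<le> n \<Longrightarrow> j < T * 16 ^ n \<Longrightarrow> \<exists>k\<in>{k0..n}.
    \<bar>f (real j / 16 ^ n + (1/4) ^ k) - f (real j / 16 ^ n)\<bar> < 13 * (1/2) ^ k" by blast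
  from small[rule_format, of "Suc T"] obtain n2 where n2: "\<And>m j. n2 \<le> m \<Longrightarrow> j < Suc T * 16 ^ m \<Longrightarrow>
    \<bar>f (real (Suc j) / 16 ^ m) - f (real j / 16 ^ m)\<bar> \<le> (1/2) ^ m" by blast
  define n where "n = max n1 n2"
  define p where "p x = real (grid_floor n x) / 16 ^ n" for x
  have osc: "\<bar>f x - f (p x)\<bar> \<le> 15 * (1/2) ^ n" if "0 \<le> x" "x < real (Suc T)" for x
    unfolding p_def
    by (rule chaining_oscillation[OF cont that n2])
       (auto simp: n_def)
  obtain k where k: "k \<in> {k0..n}" "\<bar>f (p t + (1/4) ^ k) - f (p t)\<bar> < 13 * (1/2) ^ k"
    using n1[of n "grid_floor n t"] grid_floor_less[OF t T] unfolding p_def n_def by auto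
  have "(1/4::real) ^ k \<le> 1" by (simp add: power_le_one)
  then have u: "t + (1/4) ^ k < real (Suc T)" "t < real (Suc T)" using T by simp_all
  have u': "0 \<le> t + (1/4) ^ k" using t by simp
  have o: "\<bar>f (t + (1/4) ^ k) - f (p (t + (1/4) ^ k))\<bar> \<le> 15 * (1/2) ^ n"
    "\<bar>f t - f (p t)\<bar> \<le> 15 * (1/2) ^ n"
    by (rule osc[OF u' u(1)], rule osc[OF t u(2)])
  have "p (t + (1/4) ^ k) = p t + (1/4) ^ k"
    using grid_floor_add[OF t, of k n] k by (simp add: p_def)
  with k have k': "\<bar>f (p (t + (1/4) ^ k)) - f (p t)\<bar> < 13 * (1/2) ^ k" by simp
  have pw: "(1/2::real) ^ n \<le> (1/2) ^ k" using k(1) by (intro power_decreasing) auto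
  have "\<bar>f (t + (1/4) ^ k) - f t\<bar> < 43 * (1/2) ^ k"
    by (rule abs_diff_perturb[OF o k' pw])
  with k(1) show "\<exists>k\<ge>k0. \<bar>f (t + (1/4) ^ k) - f t\<bar> < 43 * (1/2) ^ k"
    by (intro exI[of _ k] conjI) simp_all
qed

context prob_space
begin

lemma infinitely_many_small_increments_everywhere:
  assumes B: "standard_brownian_motion B"
  shows "AE \<omega> in M. \<forall>t\<ge>0. \<exists>\<^sub>\<infinity>k. \<bar>B (t + (1/4) ^ k) \<omega> - B t \<omega>\<bar> < 43 * (1/2) ^ k"
proof -
  have "AE \<omega> in M. \<forall>T k0. \<exists>n0. \<forall>n\<ge>n0. \<forall>j<T * 16 ^ n. \<exists>k\<in>{k0..n}.
      \<bar>B (real j / 16 ^ n + (1/4) ^ k) \<omega> - B (real j / 16 ^ n) \<omega>\<bar> < 13 * (1/2) ^ k"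
    unfolding AE_all_countable using eventually_no_grid_point_with_large_scales[OF B] by blast
  moreover have "AE \<omega> in M. \<forall>T. \<exists>n0. \<forall>m\<ge>n0. \<forall>j<T * 16 ^ m.
      \<bar>B (real (Suc j) / 16 ^ m) \<omega> - B (real j / 16 ^ m) \<omega>\<bar> \<le> (1/2) ^ m"
    unfolding AE_all_countable using eventually_small_grid_increments[OF B] by blast
  moreover have "AE \<omega> in M. continuous_on {0..} (\<lambda>t. B t \<omega>)"
    using standard_brownian_motion_continuous[OF B] by (rule AE_I2)
  ultimately show ?thesis
  proof eventually_elim
    case (elim \<omega>)
    show ?case
      by (intro allI impI infinitely_many_small_increments_pathwise
          elim(1)[rule_format] elim(2)[rule_format] elim(3))
  qed
qed

end

section \<open>Large increments at a fixed time\<close>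

context prob_space
begin

text \<open>
  For exceptional sets that are covered by events of small probability, so that their own measurability
  need not be established.
\<close>

lemma AE_if_outer_prob_small:
  assumes "\<And>e. 0 < e \<Longrightarrow> \<exists>A\<in>events. {\<omega>\<in>space M. \<not> P \<omega>} \<subseteq> A \<and> prob A \<le> e"
  shows "AE \<omega> in M. P \<omega>"
proof -
  have "\<exists>A\<in>events. {\<omega>\<in>space M. \<not> P \<omega>} \<subseteq> A \<and> prob A \<le> 1 / real (Suc n)" for n
    by (rule assms) simp
  then obtain A where A: "\<And>n. A n \<in> events" "\<And>n. {\<omega>\<in>space M. \<not> P \<omega>} \<subseteq> A n"
    "\<And>n. prob (A n) \<le> 1 / real (Suc n)" by metis
  have "prob (\<Inter>n. A n) \<le> 1 / real (Suc n)" for n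
    by (rule order_trans[OF finite_measure_mono A(3)]) (use A(1) in auto)
  then have "prob (\<Inter>n. A n) \<le> 0"
    by (intro LIMSEQ_le_const[OF LIMSEQ_Suc[OF lim_1_over_n]]) auto
  then have "emeasure M (\<Inter>n. A n) = 0" by (simp add: emeasure_eq_measure measure_le_0_iff)
  then show ?thesis
    by (intro AE_I[of _ _ "\<Inter>n. A n"]) (use A in auto)
qed

lemma std_normal_upper_tail_pos:
  fixes x :: real
  shows "\<exists>p>0. \<forall>Z. distributed M lborel Z std_normal_density \<longrightarrow> p \<le> prob {\<omega>\<in>space M. x < Z \<omega>}"
proof -
  let ?D = "density lborel std_normal_density"
  interpret D: prob_space ?D by (rule prob_space_normal_density) simp
  define p where "p = measure ?D {x<..}"
  have "p \<noteq> 0"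
  proof
    assume "p = 0"
    then have "AE y in ?D. y \<notin> {x<..}"
      by (intro AE_I[of _ _ "{x<..}"]) (auto simp: p_def D.emeasure_eq_measure)
    then have "AE y in lborel. y \<notin> {x<..}"
      by (subst (asm) AE_density) (auto simp: normal_density_pos less_imp_neq)
    then have "{y\<in>space lborel. \<not> y \<notin> {x<..}} \<in> null_sets lborel"
      by (subst (asm) AE_iff_null) auto
    then have "{x<..x+1} \<in> null_sets lborel"
      by (rule null_sets_subset) auto
    then show False by (simp add: null_sets_def)
  qed
  then have "0 < p" by (simp add: p_def less_le)
  moreover have "p \<le> prob {\<omega>\<in>space M. x < Z \<omega>}" if Z: "distributed M lborel Z std_normal_density" for Z
  proof -
    have "measure ?D {x<..} = measure (distr M lborel Z) {x<..}"
      using distributed_distr_eq_density[OF Z] by simp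
    also have "\<dots> = prob (Z -` {x<..} \<inter> space M)"
      using distributed_measurable[OF Z] by (intro measure_distr) auto
    also have "Z -` {x<..} \<inter> space M = {\<omega>\<in>space M. x < Z \<omega>}" by auto
    finally show ?thesis by (simp add: p_def)
  qed
  ultimately show ?thesis by blast
qed

text \<open>
  Along a subsequence \<open>\<kappa>\<close> of \<open>S\<close> with gaps at least \<open>g\<close>, the increments from \<open>t + 4^-\<kappa>(i+1)\<close> to \<open>t + 4^-\<kappa>(i)\<close>
  are independent, and \<open>c\<close> times each exceeds \<open>l * 2^-\<kappa>(i)\<close> with probability bounded from below, so one of the first
  \<open>N\<close> does so with probability close to one. The remaining part of the increment, from \<open>t\<close> to
  \<open>t + 4^-\<kappa>(i+1)\<close>, could only cancel this if it were of size \<open>2^-\<kappa>(i) \<ge> 2^g * 2^-\<kappa>(i+1)\<close>, which is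
  improbable for large \<open>g\<close>. Here \<open>N\<close> is chosen before \<open>g\<close>.
\<close>

lemma infinitely_often_large_increment:
  assumes B: "standard_brownian_motion B" and t: "0 \<le> t" and S: "infinite S" and c: "c \<noteq> 0"
  shows "AE \<omega> in M. \<exists>\<^sub>\<infinity>k. k \<in> S \<and> L * (1/2) ^ k < c * (B (t + (1/4) ^ k) \<omega> - B t \<omega>)"
  unfolding INFM_nat_le AE_all_countable
proof (intro allI AE_if_outer_prob_small)
  fix k0 :: nat and e :: real assume e: "0 < e"
  define l where "l = \<bar>L\<bar> + 1"
  have l: "1 \<le> l" "L \<le> l - 1" by (simp_all add: l_def)
  define C where "C = 2 * exp (1/2 :: real)"
  have C: "0 < C" by (simp add: C_def)
  obtain p where p: "0 < p" "\<And>Z. distributed M lborel Z std_normal_density \<Longrightarrow> p \<le> prob {\<omega>\<in>space M. 2 * l / \<bar>c\<bar> < Z \<omega>}"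
    using std_normal_upper_tail_pos[of "2 * l / \<bar>c\<bar>"] by blast
  define q where "q = max 0 (1 - p)"
  have q: "0 \<le> q" "q < 1" "1 - p \<le> q" using p(1) by (auto simp: q_def)
  obtain N0 where "q ^ N0 < e / 2" using real_arch_pow_inv[of "e/2" q] e q by auto
  moreover define N where "N = Suc N0"
  moreover have "q ^ N \<le> q ^ N0" unfolding N_def using q by (intro power_decreasing) auto
  ultimately have qN: "q ^ N < e / 2" by linarith
  have N: "0 < N" by (simp add: N_def)
  define m where "m = real (Suc N)"
  have m: "0 < m" by (simp add: m_def)
  \<comment> \<open>The tail bound C * exp (- y) is used N + 1 times and has to add up to e / 2.\<close>
  define y where "y = - ln (e / (2 * C * m))"
  have y: "m * (C * exp (- y)) = e / 2"
    using e C m by (simp add: y_def)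
  obtain g where g: "y * \<bar>c\<bar> < 2 ^ g" using real_arch_pow[of 2 "y * \<bar>c\<bar>"] by auto
  have yg: "y \<le> 2 ^ g / \<bar>c\<bar>" using g c by (simp add: field_simps)
  obtain \<kappa> :: "nat \<Rightarrow> nat" where \<kappa>: "\<And>i. \<kappa> i \<in> S \<and> k0 \<le> \<kappa> i" "\<And>i. \<kappa> i + g + 1 \<le> \<kappa> (Suc i)"
  proof -
    have ex: "\<exists>k\<ge>m. k \<in> S" for m using S infinite_nat_iff_unbounded_le by blast
    have "\<exists>\<kappa>. \<forall>i. (\<kappa> i \<in> S \<and> k0 \<le> \<kappa> i) \<and> \<kappa> i + g + 1 \<le> \<kappa> (Suc i)"
    proof (rule dependent_nat_choice)
      show "\<exists>x. x \<in> S \<and> k0 \<le> x" using ex by blast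
      show "\<exists>z. (z \<in> S \<and> k0 \<le> z) \<and> x + g + 1 \<le> z" if "x \<in> S \<and> k0 \<le> x" for x and i :: nat
        using ex[of "x + g + 1"] that by auto
    qed
    then show thesis using that by blast
  qed
  define r where "r i = t + (1/4) ^ \<kappa> i" for i
  \<comment> \<open>The same times in increasing order, as the independence of increments is stated for these.\<close>
  define u where "u j = r (N - j)" for j
  have r0: "t < r i" "0 \<le> r i" for i using t by (auto simp: r_def add_nonneg_pos)
  have rt: "r i - t = ((1/2) ^ \<kappa> i)\<^sup>2" for i
    by (simp add: r_def power2_eq_square power_mult_distrib[symmetric])
  have gap: "(((1/2) ^ \<kappa> i) / 2)\<^sup>2 \<le> r i - r (Suc i)" for i
  proof -
    have "(1/4::real) ^ \<kappa> (Suc i) \<le> (1/4) ^ Suc (\<kappa> i)" using \<kappa>(2)[of i] by (intro power_decreasing) auto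
    moreover have "(((1/2) ^ \<kappa> i) / 2)\<^sup>2 = (1/4::real) ^ Suc (\<kappa> i)"
      by (simp add: power2_eq_square power_mult_distrib[symmetric])
    moreover have "(0::real) < (1/4) ^ \<kappa> i" by simp
    ultimately show ?thesis unfolding r_def power_Suc by linarith
  qed
  have rS: "r (Suc i) < r i" for i
  proof -
    have "0 < (((1/2::real) ^ \<kappa> i) / 2)\<^sup>2" by simp
    then show ?thesis using gap[of i] by linarith
  qed
  have uS: "u j = r (Suc (N - Suc j))" "u (Suc j) = r (N - Suc j)" if "j < N" for j
    using that by (simp_all add: u_def Suc_diff_Suc)
  have uinc: "u j < u (Suc j)" if "j < N" for j using uS[OF that] rS by simp
  have u0: "0 \<le> u j" for j using r0 by (simp add: u_def)
  define I where "I j \<omega> = B (u (Suc j)) \<omega> - B (u j) \<omega>" for j \<omega>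
  define A where "A j = {x. c * x \<le> l * (1/2) ^ \<kappa> (N - Suc j)}" for j
  \<comment> \<open>On E1 no increment between neighbouring scales of the subsequence is large; on E i the scale i itself is atypically large.\<close>
  define E1 where "E1 = (\<Inter>j\<in>{..<N}. I j -` A j \<inter> space M)"
  define E where "E i = {\<omega>\<in>space M. 2 ^ g / \<bar>c\<bar> * sqrt (r i - t) \<le> \<bar>B (r i) \<omega> - B t \<omega>\<bar>}" for i
  have mB: "B s \<in> borel_measurable M" if "0 \<le> s" for s
    by (rule standard_brownian_motion_measurable[OF B that])
  have Iind: "indep_vars (\<lambda>_. borel) I {..<N}"
    unfolding I_def by (rule standard_brownian_motion_indep[where t=u, OF B u0 uinc])
  have Asets: "A j \<in> sets borel" for j unfolding A_def by measurable
  have Im: "I j \<in> borel_measurable M" for j unfolding I_def using mB[OF u0] by measurable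
  have E1m: "E1 \<in> events" unfolding E1_def using N Im Asets by (intro sets.finite_INT) auto
  have Em: "E i \<in> events" for i unfolding E_def using mB[OF r0(2)] mB[OF t] by measurable
  have pI: "prob (I j -` A j \<inter> space M) \<le> q" if j: "j < N" for j
  proof -
    define i where "i = N - Suc j"
    let ?Z = "\<lambda>\<omega>. c * (B (u (Suc j)) \<omega> - B (u j) \<omega>) / (\<bar>c\<bar> * sqrt (u (Suc j) - u j))"
    have Z: "distributed M lborel ?Z std_normal_density"
      by (rule normalized_increment[OF B u0 uinc[OF j] c])
    have Zm: "?Z \<in> borel_measurable M" using mB[OF u0] by measurable
    have "I j -` A j \<inter> space M \<subseteq> space M - {\<omega>\<in>space M. 2 * l / \<bar>c\<bar> < ?Z \<omega>}"
    proof safe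
      fix \<omega> assume "\<omega> \<in> space M" "I j \<omega> \<in> A j" and Z2: "2 * l / \<bar>c\<bar> < ?Z \<omega>"
      then have le: "c * (B (u (Suc j)) \<omega> - B (u j) \<omega>) \<le> l * (1/2) ^ \<kappa> i"
        by (simp only: A_def I_def i_def mem_Collect_eq)
      have h: "(1/2) ^ \<kappa> i / 2 \<le> sqrt (u (Suc j) - u j)"
        using gap[of i] uS[OF j] by (intro real_le_rsqrt) (simp only: i_def)
      have pos: "0 < \<bar>c\<bar> * sqrt (u (Suc j) - u j)" using c uinc[OF j] by simp
      have "2 * l / \<bar>c\<bar> * (\<bar>c\<bar> * sqrt (u (Suc j) - u j)) < c * (B (u (Suc j)) \<omega> - B (u j) \<omega>)"
        using Z2 by (simp only: pos_less_divide_eq[OF pos])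
      also have "2 * l / \<bar>c\<bar> * (\<bar>c\<bar> * sqrt (u (Suc j) - u j)) = 2 * l * sqrt (u (Suc j) - u j)"
        using c by simp
      finally have "2 * l * sqrt (u (Suc j) - u j) < l * (1/2) ^ \<kappa> i" using le by linarith
      moreover have "2 * l * ((1/2) ^ \<kappa> i / 2) \<le> 2 * l * sqrt (u (Suc j) - u j)"
        using h l by (intro mult_left_mono) auto
      ultimately show False by simp
    qed
    then have "prob (I j -` A j \<inter> space M) \<le> prob (space M - {\<omega>\<in>space M. 2 * l / \<bar>c\<bar> < ?Z \<omega>})"
      using Zm by (intro finite_measure_mono) auto
    also have "\<dots> = 1 - prob {\<omega>\<in>space M. 2 * l / \<bar>c\<bar> < ?Z \<omega>}"
      using Zm by (intro prob_compl) auto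
    also have "\<dots> \<le> q" using p(2)[OF Z] q(3) by linarith
    finally show ?thesis .
  qed
  have "prob E1 = (\<Prod>j<N. prob (I j -` A j \<inter> space M))"
    unfolding E1_def using N Asets by (intro indep_varsD_finite[OF Iind]) auto
  also have "\<dots> \<le> (\<Prod>j<N. q)" using pI by (intro prod_mono) auto
  also have "\<dots> = q ^ N" by simp
  finally have pE1: "prob E1 \<le> e / 2" using qN by linarith
  have "prob (\<Union>i\<le>N. E i) \<le> (\<Sum>i\<le>N. prob (E i))"
    using Em by (intro finite_measure_subadditive_finite) auto
  also have "\<dots> \<le> (\<Sum>i\<le>N. C * exp (- y))"
  proof (rule sum_mono)
    fix i
    have "prob (E i) \<le> C * exp (- (2 ^ g / \<bar>c\<bar>))"
      unfolding E_def C_def by (rule increment_tail[OF B t r0(1)])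
    also have "\<dots> \<le> C * exp (- y)" using C yg by (intro mult_left_mono) auto
    finally show "prob (E i) \<le> C * exp (- y)" .
  qed
  also have "\<dots> = e / 2" using y by (simp add: m_def)
  finally have pE2: "prob (\<Union>i\<le>N. E i) \<le> e / 2" .
  show "\<exists>A\<in>events. {\<omega>\<in>space M. \<not> (\<exists>k\<ge>k0. k \<in> S \<and> L * (1/2) ^ k < c * (B (t + (1/4) ^ k) \<omega> - B t \<omega>))} \<subseteq> A \<and> prob A \<le> e"
  proof (intro bexI[of _ "E1 \<union> (\<Union>i\<le>N. E i)"] conjI)
    show "E1 \<union> (\<Union>i\<le>N. E i) \<in> events" using E1m Em by auto
    have "prob (E1 \<union> (\<Union>i\<le>N. E i)) \<le> prob E1 + prob (\<Union>i\<le>N. E i)"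
      using E1m Em by (intro measure_Un_le) auto
    then show "prob (E1 \<union> (\<Union>i\<le>N. E i)) \<le> e" using pE1 pE2 by linarith
    show "{\<omega>\<in>space M. \<not> (\<exists>k\<ge>k0. k \<in> S \<and> L * (1/2) ^ k < c * (B (t + (1/4) ^ k) \<omega> - B t \<omega>))} \<subseteq> E1 \<union> (\<Union>i\<le>N. E i)"
    proof (intro subsetI)
      fix \<omega> assume "\<omega> \<in> {\<omega>\<in>space M. \<not> (\<exists>k\<ge>k0. k \<in> S \<and> L * (1/2) ^ k < c * (B (t + (1/4) ^ k) \<omega> - B t \<omega>))}"
      then have \<omega>: "\<omega> \<in> space M" and "\<not> (\<exists>k\<ge>k0. k \<in> S \<and> L * (1/2) ^ k < c * (B (t + (1/4) ^ k) \<omega> - B t \<omega>))"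
        by auto
      then have up: "c * (B (r i) \<omega> - B t \<omega>) \<le> L * (1/2) ^ \<kappa> i" for i
        using \<kappa>(1)[of i] unfolding r_def by (meson not_le)
      have "\<omega> \<in> E1" if "\<omega> \<notin> (\<Union>i\<le>N. E i)"
        unfolding E1_def
      proof (intro INT_I IntI vimageI2 \<omega>)
        fix j assume "j \<in> {..<N}"
        then have j: "j < N" by simp
        define i where "i = N - Suc j"
        have "Suc i \<le> N" using j by (simp add: i_def)
        then have "\<bar>B (r (Suc i)) \<omega> - B t \<omega>\<bar> < 2 ^ g / \<bar>c\<bar> * sqrt (r (Suc i) - t)"
          using that \<omega> unfolding E_def by force
        also have "sqrt (r (Suc i) - t) = (1/2) ^ \<kappa> (Suc i)" unfolding rt by simp
        finally have "\<bar>c\<bar> * \<bar>B (r (Suc i)) \<omega> - B t \<omega>\<bar> < \<bar>c\<bar> * (2 ^ g / \<bar>c\<bar> * (1/2) ^ \<kappa> (Suc i))"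
          using c by (intro mult_strict_left_mono) auto
        then have lo: "\<bar>c * (B (r (Suc i)) \<omega> - B t \<omega>)\<bar> < 2 ^ g * (1/2) ^ \<kappa> (Suc i)"
          using c by (simp add: abs_mult)
        have "(2::real) ^ g * (1/2) ^ \<kappa> (Suc i) \<le> 2 ^ g * (1/2) ^ (g + \<kappa> i)"
          using \<kappa>(2)[of i] by (intro mult_left_mono power_decreasing) auto
        also have "\<dots> = (1/2) ^ \<kappa> i" by (simp add: power_add power_one_over)
        finally have "- ((1/2) ^ \<kappa> i) \<le> c * (B (r (Suc i)) \<omega> - B t \<omega>)" using lo by linarith
        moreover have "L * (1/2) ^ \<kappa> i \<le> (l - 1) * (1/2) ^ \<kappa> i" using l by (intro mult_right_mono) auto
        moreover have "c * I j \<omega> = c * (B (r i) \<omega> - B t \<omega>) - c * (B (r (Suc i)) \<omega> - B t \<omega>)"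
          using uS[OF j] by (simp add: I_def i_def right_diff_distrib)
        ultimately have "c * I j \<omega> \<le> l * (1/2) ^ \<kappa> i" using up[of i] by (simp only: left_diff_distrib mult_1_left)
        then show "I j \<omega> \<in> A j" by (simp add: A_def i_def)
      qed
      then show "\<omega> \<in> E1 \<union> (\<Union>i\<le>N. E i)" by auto
    qed
  qed
qed

end

section \<open>Maxima over disjoint intervals differ\<close>

context prob_space
begin

text \<open>
  Fubini's theorem for independent random elements, as a bound on sections that is uniform in the first
  component. It serves both for small probabilities and, with \<open>C = 0\<close>, for null sets.
\<close>

lemma indep_var_section_bound:
  assumes ind: "indep_var S X T Y" and A: "A \<in> sets (S \<Otimes>\<^sub>M T)"
    and bound: "\<And>x. x \<in> space S \<Longrightarrow> emeasure M {\<omega>\<in>space M. (x, Y \<omega>) \<in> A} \<le> C"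
  shows "emeasure M {\<omega>\<in>space M. (X \<omega>, Y \<omega>) \<in> A} \<le> C"
proof -
  have X: "X \<in> measurable M S" and Y: "Y \<in> measurable M T"
    and eq: "distr M S X \<Otimes>\<^sub>M distr M T Y = distr M (S \<Otimes>\<^sub>M T) (\<lambda>\<omega>. (X \<omega>, Y \<omega>))"
    using ind by (auto simp: indep_var_distribution_eq)
  interpret DX: prob_space "distr M S X" by (rule prob_space_distr[OF X])
  interpret DY: prob_space "distr M T Y" by (rule prob_space_distr[OF Y])
  have "emeasure M {\<omega>\<in>space M. (X \<omega>, Y \<omega>) \<in> A} = emeasure (distr M (S \<Otimes>\<^sub>M T) (\<lambda>\<omega>. (X \<omega>, Y \<omega>))) A"
    using X Y A by (subst emeasure_distr) (auto intro!: arg_cong[where f="emeasure M"])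
  also have "\<dots> = emeasure (distr M S X \<Otimes>\<^sub>M distr M T Y) A" by (simp only: eq)
  also have "\<dots> = (\<integral>\<^sup>+x. emeasure (distr M T Y) (Pair x -` A) \<partial>distr M S X)"
    using A by (intro DY.emeasure_pair_measure_alt) simp
  also have "\<dots> \<le> (\<integral>\<^sup>+x. C \<partial>distr M S X)"
  proof (rule nn_integral_mono)
    fix x assume x: "x \<in> space (distr M S X)"
    have "Pair x -` A \<in> sets T" using A by (rule sets_Pair1)
    then have "emeasure (distr M T Y) (Pair x -` A) = emeasure M (Y -` (Pair x -` A) \<inter> space M)"
      using Y by (intro emeasure_distr)
    also have "Y -` (Pair x -` A) \<inter> space M = {\<omega>\<in>space M. (x, Y \<omega>) \<in> A}" by auto
    finally show "emeasure (distr M T Y) (Pair x -` A) \<le> C" using bound x by simp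
  qed
  also have "\<dots> = C" using DX.emeasure_space_1 by simp
  finally show ?thesis .
qed

text \<open>
  The standard normal density is at most \<open>1\<close>.
\<close>

lemma std_normal_small_ball:
  assumes Z: "distributed M lborel Z std_normal_density" and k: "k \<noteq> 0"  and d: "0 \<le> \<delta>"
  shows "emeasure M {\<omega>\<in>space M. \<bar>x + k * Z \<omega>\<bar> \<le> \<delta>} \<le> ennreal (2 * \<delta> / \<bar>k\<bar>)"
proof -
  let ?J = "{- x / k - \<delta> / \<bar>k\<bar> .. - x / k + \<delta> / \<bar>k\<bar>}"
  have eq: "{\<omega>\<in>space M. \<bar>x + k * Z \<omega>\<bar> \<le> \<delta>} \<subseteq> Z -` ?J \<inter> space M"
  proof (intro subsetI)
    fix \<omega> assume "\<omega> \<in> {\<omega>\<in>space M. \<bar>x + k * Z \<omega>\<bar> \<le> \<delta>}"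
    then have \<omega>: "\<omega> \<in> space M" and le: "\<bar>x + k * Z \<omega>\<bar> \<le> \<delta>" by auto
    have "\<bar>x / k + Z \<omega>\<bar> = \<bar>x + k * Z \<omega>\<bar> / \<bar>k\<bar>" using k by (simp add: abs_divide[symmetric] add_divide_distrib)
    also have "\<dots> \<le> \<delta> / \<bar>k\<bar>" using le by (intro divide_right_mono) auto
    finally have "Z \<omega> \<in> ?J" by (simp add: abs_le_iff)
    with \<omega> show "\<omega> \<in> Z -` ?J \<inter> space M" by simp
  qed
  have "emeasure M {\<omega>\<in>space M. \<bar>x + k * Z \<omega>\<bar> \<le> \<delta>} \<le> emeasure M (Z -` ?J \<inter> space M)"
    using distributed_measurable[OF Z] eq by (intro emeasure_mono) auto
  also have "\<dots> = (\<integral>\<^sup>+z. ennreal (std_normal_density z) * indicator ?J z \<partial>lborel)"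
    by (rule distributed_emeasure[OF Z]) simp
  also have "\<dots> \<le> (\<integral>\<^sup>+z. indicator ?J z \<partial>lborel)"
  proof (rule nn_integral_mono)
    fix z
    have "1 \<le> sqrt (2 * pi)" using pi_gt3 by simp
    then have "std_normal_density z \<le> 1 * 1"
      unfolding std_normal_density_def by (intro mult_mono) auto
    then show "ennreal (std_normal_density z) * indicator ?J z \<le> indicator ?J z"
      by (auto simp: indicator_def)
  qed
  also have "\<dots> = emeasure lborel ?J" by simp
  also have "\<dots> = ennreal (2 * \<delta> / \<bar>k\<bar>)" using d by (subst emeasure_lborel_Icc) auto
  finally show ?thesis .
qed

text \<open>
  With \<open>B (t 0)\<close> removed from both maxima, the only part of their difference that involves the increment
  \<open>I m\<close> across the gap is that increment itself: it is added to every term of the right maximum and to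
  none of the left one. The rest, \<open>G\<close>, is a function of the other increments, so conditionally on it the
  difference is a normal variable with standard deviation \<open>\<bar>\<sigma>\<bar> * sqrt (t (m+1) - t m)\<close>.
\<close>

lemma tied_grid_maxima_prob:
  assumes B: "standard_brownian_motion B" and s: "\<sigma> \<noteq> 0" and d: "0 \<le> \<delta>"
    and t: "\<And>i. 0 \<le> t i" "\<And>i. i < N \<Longrightarrow> t i < t (Suc i)" and m: "m < N"
  shows "prob {\<omega>\<in>space M. \<bar>Max ((\<lambda>i. \<phi> (t i) + \<sigma> * B (t i) \<omega>) ` {m<..N}) - Max ((\<lambda>i. \<phi> (t i) + \<sigma> * B (t i) \<omega>) ` {..m})\<bar> \<le> \<delta>}
    \<le> 2 * \<delta> / (\<bar>\<sigma>\<bar> * sqrt (t (Suc m) - t m))"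
proof -
  define I where "I j \<omega> = B (t (Suc j)) \<omega> - B (t j) \<omega>" for j \<omega>
  define J where "J = {..<N} - {m}"
  define H where "H i v = \<phi> (t i) + \<sigma> * (\<Sum>j\<in>{..<i} - {m}. v j)" for i and v :: "nat \<Rightarrow> real"
  define G where "G v = Max ((\<lambda>i. H i v) ` {m<..N}) - Max ((\<lambda>i. H i v) ` {..m})" for v
  define k where "k = \<sigma> * sqrt (t (Suc m) - t m)"
  define Z where "Z \<omega> = 1 * (B (t (Suc m)) \<omega> - B (t m) \<omega>) / (\<bar>1\<bar> * sqrt (t (Suc m) - t m))" for \<omega>
  have rt: "0 < sqrt (t (Suc m) - t m)" using t(2)[OF m] by simp
  have k: "k \<noteq> 0" using s rt by (simp add: k_def)
  have Z: "distributed M lborel Z std_normal_density"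
    unfolding Z_def by (rule normalized_increment[OF B t(1) t(2)[OF m]]) simp
  have kZ: "k * Z \<omega> = \<sigma> * I m \<omega>" for \<omega> using rt by (simp add: k_def Z_def I_def)
  have mono: "{..<i} - {m} \<subseteq> J" if "i \<le> N" for i using that by (auto simp: J_def)
  have Hm: "H i \<in> borel_measurable (Pi\<^sub>M J (\<lambda>_. borel))" if "i \<le> N" for i
    unfolding H_def using mono[OF that]
    by (intro borel_measurable_add borel_measurable_times borel_measurable_sum borel_measurable_const
        measurable_component_singleton) auto
  have Gm: "G \<in> borel_measurable (Pi\<^sub>M J (\<lambda>_. borel))"
    unfolding G_def by (intro borel_measurable_diff borel_measurable_Max Hm) (use m in auto)
  have "indep_var (Pi\<^sub>M J (\<lambda>_. borel)) (\<lambda>\<omega>. \<lambda>j\<in>J. I j \<omega>) (Pi\<^sub>M {m} (\<lambda>_. borel)) (\<lambda>\<omega>. \<lambda>j\<in>{m}. I j \<omega>)"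
  proof (rule indep_var_restrict)
    show "indep_vars (\<lambda>_. borel) I {..<N}"
      unfolding I_def by (rule standard_brownian_motion_indep[where t=t, OF B t])
  qed (use m in \<open>auto simp: J_def\<close>)
  then have "indep_var borel (G \<circ> (\<lambda>\<omega>. \<lambda>j\<in>J. I j \<omega>)) borel
      ((\<lambda>v. v m / sqrt (t (Suc m) - t m)) \<circ> (\<lambda>\<omega>. \<lambda>j\<in>{m}. I j \<omega>))"
    by (rule indep_var_compose[OF _ Gm]) measurable
  moreover have "(\<lambda>v. v m / sqrt (t (Suc m) - t m)) \<circ> (\<lambda>\<omega>. \<lambda>j\<in>{m}. I j \<omega>) = Z"
    by (auto simp: Z_def I_def fun_eq_iff)
  ultimately have ind: "indep_var borel (\<lambda>\<omega>. G (\<lambda>j\<in>J. I j \<omega>)) borel Z" by (simp add: comp_def)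
  have split: "\<phi> (t i) + \<sigma> * B (t i) \<omega> = H i (\<lambda>j\<in>J. I j \<omega>) + (\<sigma> * B (t 0) \<omega> + (if m < i then \<sigma> * I m \<omega> else 0))"
    if "i \<le> N" for i \<omega>
  proof -
    have "B (t i) \<omega> - B (t 0) \<omega> = (\<Sum>j<i. I j \<omega>)"
      unfolding I_def by (rule sum_lessThan_telescope[symmetric])
    also have "\<dots> = (\<Sum>j\<in>{..<i} - {m}. I j \<omega>) + (if m < i then I m \<omega> else 0)"
      by (cases "m < i") (auto simp: sum.remove[of "{..<i}" m])
    also have "(\<Sum>j\<in>{..<i} - {m}. I j \<omega>) = (\<Sum>j\<in>{..<i} - {m}. (\<lambda>j\<in>J. I j \<omega>) j)"
      using mono[OF that] by (intro sum.cong) auto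
    finally have "B (t i) \<omega> = (\<Sum>j\<in>{..<i} - {m}. (\<lambda>j\<in>J. I j \<omega>) j) + (if m < i then I m \<omega> else 0) + B (t 0) \<omega>"
      by linarith
    then show ?thesis unfolding H_def by (simp add: distrib_left)
  qed
  have diff: "Max ((\<lambda>i. \<phi> (t i) + \<sigma> * B (t i) \<omega>) ` {m<..N}) - Max ((\<lambda>i. \<phi> (t i) + \<sigma> * B (t i) \<omega>) ` {..m})
      = G (\<lambda>j\<in>J. I j \<omega>) + k * Z \<omega>" for \<omega>
  proof -
    have "(\<lambda>i. \<phi> (t i) + \<sigma> * B (t i) \<omega>) ` {m<..N} = (\<lambda>i. H i (\<lambda>j\<in>J. I j \<omega>) + (\<sigma> * B (t 0) \<omega> + \<sigma> * I m \<omega>)) ` {m<..N}"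
      by (intro image_cong refl) (simp add: split)
    moreover have "(\<lambda>i. \<phi> (t i) + \<sigma> * B (t i) \<omega>) ` {..m} = (\<lambda>i. H i (\<lambda>j\<in>J. I j \<omega>) + \<sigma> * B (t 0) \<omega>) ` {..m}"
      using m by (intro image_cong refl) (simp add: split)
    ultimately show ?thesis
      using m by (simp add: Max_add_commute G_def kZ)
  qed
  have A: "{p \<in> space (borel \<Otimes>\<^sub>M borel). \<bar>fst p + k * snd p\<bar> \<le> \<delta>} \<in> sets (borel \<Otimes>\<^sub>M (borel :: real measure))"
    by measurable
  have "emeasure M {\<omega>\<in>space M. (G (\<lambda>j\<in>J. I j \<omega>), Z \<omega>) \<in> {p \<in> space (borel \<Otimes>\<^sub>M borel). \<bar>fst p + k * snd p\<bar> \<le> \<delta>}}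
      \<le> ennreal (2 * \<delta> / \<bar>k\<bar>)"
    by (rule indep_var_section_bound[OF ind A])
       (use std_normal_small_ball[OF Z k d] in \<open>simp add: space_pair_measure\<close>)
  then have "emeasure M {\<omega>\<in>space M. \<bar>G (\<lambda>j\<in>J. I j \<omega>) + k * Z \<omega>\<bar> \<le> \<delta>} \<le> ennreal (2 * \<delta> / \<bar>k\<bar>)"
    by (simp add: space_pair_measure)
  then have "prob {\<omega>\<in>space M. \<bar>G (\<lambda>j\<in>J. I j \<omega>) + k * Z \<omega>\<bar> \<le> \<delta>} \<le> 2 * \<delta> / \<bar>k\<bar>"
    using d by (simp add: emeasure_eq_measure)
  then show ?thesis unfolding diff using rt by (simp add: k_def abs_mult)
qed

end

lemma tendsto_Max_image:
  fixes f :: "real \<Rightarrow> real"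
  assumes cont: "continuous_on {a..b} f" and s: "s \<in> {a..b}" and max: "\<And>r. r \<in> {a..b} \<Longrightarrow> f r \<le> f s"
    and A: "\<And>n. finite (A n)" "\<And>n. A n \<subseteq> {a..b}" and p: "\<And>n. p n \<in> A n" "p \<longlonglongrightarrow> s"
  shows "(\<lambda>n. Max (f ` A n)) \<longlonglongrightarrow> f s"
proof (rule real_tendsto_sandwich)
  have "p n \<in> {a..b}" for n using A(2) p(1) by blast
  then show "(\<lambda>n. f (p n)) \<longlonglongrightarrow> f s"
    by (intro continuous_on_tendsto_compose[OF cont p(2) s]) auto
  show "\<forall>\<^sub>F n in sequentially. f (p n) \<le> Max (f ` A n)"
    using A(1) p(1) by (intro always_eventually allI Max_ge) auto
  show "\<forall>\<^sub>F n in sequentially. Max (f ` A n) \<le> f s"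
  proof (intro always_eventually allI)
    fix n
    have "f r \<le> f s" if "r \<in> A n" for r using A(2)[of n] that by (intro max) blast
    then show "Max (f ` A n) \<le> f s" using A(1)[of n] p(1)[of n] by (subst Max_le_iff) auto
  qed
qed simp

definition grid_point :: "real \<Rightarrow> real \<Rightarrow> nat \<Rightarrow> nat \<Rightarrow> real" where
  "grid_point a b n i = a + (b - a) * (real i / real (Suc n))"

lemma grid_point_in_interval:
  assumes "a \<le> b" "i \<le> Suc n"
  shows "grid_point a b n i \<in> {a..b}"
proof -
  have "(b - a) * (real i / real (Suc n)) \<le> (b - a) * 1" using assms by (intro mult_left_mono) auto
  then show ?thesis using assms by (simp add: grid_point_def)
qed

lemma nearest_grid_point:
  fixes a b s :: real
  assumes "a < b" "s \<in> {a..b}"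
  obtains i where "\<And>n. i n \<le> Suc n" "(\<lambda>n. grid_point a b n (i n)) \<longlonglongrightarrow> s"
proof -
  define u where "u = (s - a) / (b - a)"
  have u: "0 \<le> u" "u \<le> 1" "a + (b - a) * u = s" using assms by (auto simp: u_def)
  define i where "i n = nat \<lfloor>real (Suc n) * u\<rfloor>" for n
  have ri: "real (i n) = of_int \<lfloor>real (Suc n) * u\<rfloor>" for n using u by (simp add: i_def)
  have bounds: "real (i n) \<le> real (Suc n) * u" "real (Suc n) * u < real (i n) + 1" for n
    unfolding ri by linarith+
  have "real (i n) \<le> real (Suc n) * 1" for n
    using bounds(1)[of n] mult_left_mono[OF u(2) of_nat_0_le_iff] by (rule order_trans)
  then have i: "i n \<le> Suc n" for n by (simp only: mult_1_right of_nat_le_iff)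
  have "(\<lambda>n. real (i n) / real (Suc n)) \<longlonglongrightarrow> u"
  proof (rule real_tendsto_sandwich)
    show "\<forall>\<^sub>F n in sequentially. u - 1 / real (Suc n) \<le> real (i n) / real (Suc n)"
    proof (intro always_eventually allI)
      fix n
      have "u < (real (i n) + 1) / real (Suc n)"
        using bounds(2)[of n] by (simp add: pos_less_divide_eq mult.commute)
      then show "u - 1 / real (Suc n) \<le> real (i n) / real (Suc n)"
        unfolding add_divide_distrib by linarith
    qed
    show "\<forall>\<^sub>F n in sequentially. real (i n) / real (Suc n) \<le> u"
    proof (intro always_eventually allI)
      fix n
      show "real (i n) / real (Suc n) \<le> u"
        using bounds(1)[of n] by (simp add: pos_divide_le_eq mult.commute)
    qed
    show "(\<lambda>n. u - 1 / real (Suc n)) \<longlonglongrightarrow> u"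
      using tendsto_diff[OF tendsto_const LIMSEQ_Suc[OF lim_1_over_n], of u] by simp
  qed simp
  then have "(\<lambda>n. a + (b - a) * (real (i n) / real (Suc n))) \<longlonglongrightarrow> a + (b - a) * u"
    by (intro tendsto_intros)
  then show thesis using that[of i] i u(3) by (simp add: grid_point_def)
qed

context prob_space
begin

text \<open>
  Equal maxima over the two intervals force the maxima over grids to be eventually within any \<open>\<delta>\<close> of each
  other. By \<open>tied_grid_maxima_prob\<close> this has a probability of order \<open>\<delta>\<close> uniformly in the grid, since every
  grid contains \<open>b\<close> and \<open>c\<close> as neighbouring points.
\<close>

lemma no_equal_maxima_on_disjoint_intervals:
  assumes B: "standard_brownian_motion B" and s: "\<sigma> \<noteq> 0" and cont: "continuous_on {0..} \<phi>"
    and ab: "0 \<le> a" "a < b" "b < c" "c < d"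
  shows "AE \<omega> in M. \<not> (\<exists>s\<in>{a..b}. \<exists>s'\<in>{c..d}.
      \<phi> s + \<sigma> * B s \<omega> = \<phi> s' + \<sigma> * B s' \<omega> \<and>
      (\<forall>r\<in>{a..b}. \<phi> r + \<sigma> * B r \<omega> \<le> \<phi> s + \<sigma> * B s \<omega>) \<and>
      (\<forall>r\<in>{c..d}. \<phi> r + \<sigma> * B r \<omega> \<le> \<phi> s' + \<sigma> * B s' \<omega>))"
proof (rule AE_if_outer_prob_small)
  fix e :: real assume e: "0 < e"
  define \<delta> where "\<delta> = e * (\<bar>\<sigma>\<bar> * sqrt (c - b)) / 2"
  have \<delta>: "0 < \<delta>" "2 * \<delta> / (\<bar>\<sigma>\<bar> * sqrt (c - b)) = e" using e s ab by (auto simp: \<delta>_def)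
  define t where "t n i = (if i \<le> Suc n then grid_point a b n i else grid_point c d n (i - Suc (Suc n)))" for n i
  define E where "E n = {\<omega>\<in>space M. \<bar>Max ((\<lambda>i. \<phi> (t n i) + \<sigma> * B (t n i) \<omega>) ` {Suc n<..2 * Suc n + 1})
      - Max ((\<lambda>i. \<phi> (t n i) + \<sigma> * B (t n i) \<omega>) ` {..Suc n})\<bar> \<le> \<delta>}" for n
  have t0: "0 \<le> t n i" for n i using ab by (auto simp: t_def grid_point_def)
  have tm: "t n (Suc n) = b" "t n (Suc (Suc n)) = c" for n by (simp_all add: t_def grid_point_def)
  have tinc: "t n i < t n (Suc i)" if "i < 2 * Suc n + 1" for n i
  proof -
    consider "Suc i \<le> Suc n" | "i = Suc n" | "Suc n < i" by linarith
    then show ?thesis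
    proof cases
      case 1
      have "(b - a) * (real i / real (Suc n)) < (b - a) * (real (Suc i) / real (Suc n))"
        using ab by (intro mult_strict_left_mono divide_strict_right_mono) auto
      then show ?thesis using 1 unfolding t_def grid_point_def by simp
    next
      case 2
      then show ?thesis using ab by (simp add: tm)
    next
      case 3
      then have "(d - c) * (real (i - Suc (Suc n)) / real (Suc n)) < (d - c) * (real (Suc i - Suc (Suc n)) / real (Suc n))"
        using ab by (intro mult_strict_left_mono divide_strict_right_mono) auto
      then show ?thesis using 3 unfolding t_def grid_point_def by simp
    qed
  qed
  have mB: "B r \<in> borel_measurable M" if "0 \<le> r" for r
    by (rule standard_brownian_motion_measurable[OF B that])
  have Em: "E n \<in> events" for n
    unfolding E_def using mB[OF t0] by measurable
  have pE: "prob (E n) \<le> e" for n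
    unfolding E_def \<delta>(2)[symmetric]
    using tied_grid_maxima_prob[where t="t n" and m="Suc n" and N="2 * Suc n + 1" and \<phi>=\<phi>,
        OF B s less_imp_le[OF \<delta>(1)] t0 tinc]
    unfolding tm by simp
  \<comment> \<open>The lower limit of the events E n.\<close>
  define A where "A k = (\<Inter>n\<in>{k..}. E n)" for k
  have Am: "A k \<in> events" for k unfolding A_def using Em by (intro sets.countable_INT) auto
  have "prob (A k) \<le> e" for k
    by (rule order_trans[OF finite_measure_mono pE[of k]]) (use Em in \<open>auto simp: A_def\<close>)
  moreover have "(\<lambda>k. prob (A k)) \<longlonglongrightarrow> prob (\<Union>k. A k)"
    using Am by (intro finite_Lim_measure_incseq) (auto simp: A_def incseq_def)
  ultimately have pA: "prob (\<Union>k. A k) \<le> e" by (intro LIMSEQ_le_const2) auto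
  show "\<exists>A\<in>events. {\<omega>\<in>space M. \<not> \<not> (\<exists>s\<in>{a..b}. \<exists>s'\<in>{c..d}.
      \<phi> s + \<sigma> * B s \<omega> = \<phi> s' + \<sigma> * B s' \<omega> \<and>
      (\<forall>r\<in>{a..b}. \<phi> r + \<sigma> * B r \<omega> \<le> \<phi> s + \<sigma> * B s \<omega>) \<and>
      (\<forall>r\<in>{c..d}. \<phi> r + \<sigma> * B r \<omega> \<le> \<phi> s' + \<sigma> * B s' \<omega>))} \<subseteq> A \<and> prob A \<le> e"
  proof (intro bexI[of _ "\<Union>k. A k"] conjI pA)
    show "(\<Union>k. A k) \<in> events" using Am by auto
    show "{\<omega>\<in>space M. \<not> \<not> (\<exists>s\<in>{a..b}. \<exists>s'\<in>{c..d}.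
      \<phi> s + \<sigma> * B s \<omega> = \<phi> s' + \<sigma> * B s' \<omega> \<and>
      (\<forall>r\<in>{a..b}. \<phi> r + \<sigma> * B r \<omega> \<le> \<phi> s + \<sigma> * B s \<omega>) \<and>
      (\<forall>r\<in>{c..d}. \<phi> r + \<sigma> * B r \<omega> \<le> \<phi> s' + \<sigma> * B s' \<omega>))} \<subseteq> (\<Union>k. A k)"
    proof (intro subsetI, unfold mem_Collect_eq not_not, elim conjE bexE)
      fix \<omega> s s'
      assume \<omega>: "\<omega> \<in> space M" and s: "s \<in> {a..b}" and s': "s' \<in> {c..d}"
        and eq: "\<phi> s + \<sigma> * B s \<omega> = \<phi> s' + \<sigma> * B s' \<omega>"
        and max: "\<forall>r\<in>{a..b}. \<phi> r + \<sigma> * B r \<omega> \<le> \<phi> s + \<sigma> * B s \<omega>"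
        and max': "\<forall>r\<in>{c..d}. \<phi> r + \<sigma> * B r \<omega> \<le> \<phi> s' + \<sigma> * B s' \<omega>"
      let ?f = "\<lambda>r. \<phi> r + \<sigma> * B r \<omega>"
      have cf: "continuous_on {0..} ?f"
        by (intro continuous_intros cont standard_brownian_motion_continuous[OF B \<omega>])
      obtain i where i: "\<And>n. i n \<le> Suc n" "(\<lambda>n. grid_point a b n (i n)) \<longlonglongrightarrow> s"
        using nearest_grid_point[OF ab(2) s] by blast
      obtain j where j: "\<And>n. j n \<le> Suc n" "(\<lambda>n. grid_point c d n (j n)) \<longlonglongrightarrow> s'"
        using nearest_grid_point[OF ab(4) s'] by blast
      have "(\<lambda>n. Max (?f ` (t n ` {..Suc n}))) \<longlonglongrightarrow> ?f s"
      proof (rule tendsto_Max_image[OF continuous_on_subset[OF cf] s])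
        show "t n ` {..Suc n} \<subseteq> {a..b}" for n
        proof (rule image_subsetI)
          fix l assume "l \<in> {..Suc n}"
          then show "t n l \<in> {a..b}" using grid_point_in_interval[of a b l n] ab by (simp add: t_def)
        qed
        show "t n (i n) \<in> t n ` {..Suc n}" for n using i(1) by auto
        show "(\<lambda>n. t n (i n)) \<longlonglongrightarrow> s" using i unfolding t_def by simp
      qed (use ab max in auto)
      moreover have "(\<lambda>n. Max (?f ` (t n ` {Suc n<..2 * Suc n + 1}))) \<longlonglongrightarrow> ?f s'"
      proof (rule tendsto_Max_image[OF continuous_on_subset[OF cf] s'])
        show "t n ` {Suc n<..2 * Suc n + 1} \<subseteq> {c..d}" for n
        proof (rule image_subsetI)
          fix l assume "l \<in> {Suc n<..2 * Suc n + 1}"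
          then have "\<not> l \<le> Suc n" "l - Suc (Suc n) \<le> Suc n" by auto
          then show "t n l \<in> {c..d}" using grid_point_in_interval[of c d "l - Suc (Suc n)" n] ab
            by (simp only: t_def if_False less_imp_le)
        qed
        show "t n (j n + Suc (Suc n)) \<in> t n ` {Suc n<..2 * Suc n + 1}" for n
          using j(1)[of n] by (intro imageI) auto
        show "(\<lambda>n. t n (j n + Suc (Suc n))) \<longlonglongrightarrow> s'" using j unfolding t_def by simp
      qed (use ab max' in auto)
      ultimately have "(\<lambda>n. \<bar>Max (?f ` (t n ` {Suc n<..2 * Suc n + 1})) - Max (?f ` (t n ` {..Suc n}))\<bar>) \<longlonglongrightarrow> \<bar>?f s' - ?f s\<bar>"
        by (intro tendsto_intros)
      moreover have "\<bar>?f s' - ?f s\<bar> < \<delta>" using eq \<delta> by simp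
      ultimately have "\<forall>\<^sub>F n in sequentially. \<bar>Max (?f ` (t n ` {Suc n<..2 * Suc n + 1})) - Max (?f ` (t n ` {..Suc n}))\<bar> < \<delta>"
        by (rule order_tendstoD)
      then obtain k where "\<And>n. k \<le> n \<Longrightarrow> \<bar>Max (?f ` (t n ` {Suc n<..2 * Suc n + 1})) - Max (?f ` (t n ` {..Suc n}))\<bar> < \<delta>"
        unfolding eventually_sequentially by blast
      then have "\<omega> \<in> A k" using \<omega> unfolding A_def E_def by (auto simp: image_image intro!: less_imp_le)
      then show "\<omega> \<in> (\<Union>k. A k)" by blast
    qed
  qed
qed

end

section \<open>Large increments at a maximum point of an independent path\<close>

text \<open>
  Evaluation of a path at a time that itself depends on the path. The map \<open>(f, t) \<mapsto> f t\<close> is not measurable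
  for the product sigma-algebra on all functions; approximation through a countable set of times makes it
  measurable and agrees with evaluation on continuous paths.
\<close>

definition eval_lim :: "(real \<Rightarrow> real) \<Rightarrow> real \<Rightarrow> real" where
  "eval_lim f t = lim (\<lambda>n. f (real (grid_floor n t) / 16 ^ n))"

lemma eval_lim_eq:
  assumes "continuous_on {0..} f" "0 \<le> t"
  shows "eval_lim (\<lambda>t\<in>{0..}. f t) t = f t"
proof -
  have "(\<lambda>n. f (real (grid_floor n t) / 16 ^ n)) \<longlonglongrightarrow> f t"
    by (rule continuous_on_tendsto_compose[OF assms(1) grid_floor_tendsto[OF assms(2)]]) (use assms in auto)
  then have "(\<lambda>n. (\<lambda>t\<in>{0..}. f t) (real (grid_floor n t) / 16 ^ n)) \<longlonglongrightarrow> f t" by simp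
  then show ?thesis unfolding eval_lim_def by (rule limI)
qed

lemma eval_lim_measurable:
  assumes F: "F \<in> measurable M (Pi\<^sub>M {0..} (\<lambda>_. borel))" and g: "g \<in> borel_measurable M"
  shows "(\<lambda>x. eval_lim (F x) (g x)) \<in> borel_measurable M"
  unfolding eval_lim_def
proof (rule borel_measurable_lim_metric)
  fix n
  have "(\<lambda>x. F x (real i / 16 ^ n)) \<in> borel_measurable M" for i :: nat
    by (rule measurable_compose[OF F measurable_component_singleton]) simp
  moreover have "(\<lambda>x. grid_floor n (g x)) \<in> measurable M (count_space UNIV)"
    unfolding grid_floor_def using g by measurable
  ultimately show "(\<lambda>x. F x (real (grid_floor n (g x)) / 16 ^ n)) \<in> borel_measurable M"
    by (rule measurable_compose_countable)
qed

definition grid_argmax :: "real \<Rightarrow> real \<Rightarrow> (real \<Rightarrow> real) \<Rightarrow> nat \<Rightarrow> nat" where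
  "grid_argmax a b f n =
    (LEAST i. i \<le> Suc n \<and> (\<forall>j\<in>{..Suc n}. f (grid_point a b n j) \<le> f (grid_point a b n i)))"

text \<open>
  A maximum point as a measurable function of the path: the position of a grid maximum is the least of
  finitely many indices with a measurable property, and the limit exists whenever the maximum point is unique (\<open>argmax_lim_eq\<close>).
\<close>

definition argmax_lim :: "real \<Rightarrow> real \<Rightarrow> (real \<Rightarrow> real) \<Rightarrow> real" where
  "argmax_lim a b f = lim (\<lambda>n. grid_point a b n (grid_argmax a b f n))"

lemma grid_argmax:
  "grid_argmax a b f n \<le> Suc n"
  "j \<le> Suc n \<Longrightarrow> f (grid_point a b n j) \<le> f (grid_point a b n (grid_argmax a b f n))"
proof -
  let ?F = "(\<lambda>j. f (grid_point a b n j)) ` {..Suc n}"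
  have "Max ?F \<in> ?F" by (intro Max_in) auto
  then obtain i where i: "i \<le> Suc n" "Max ?F = f (grid_point a b n i)" by (elim imageE) simp
  have "i \<le> Suc n \<and> (\<forall>j\<in>{..Suc n}. f (grid_point a b n j) \<le> f (grid_point a b n i))"
    using i by (auto simp flip: i(2))
  from LeastI[of "\<lambda>i. i \<le> Suc n \<and> (\<forall>j\<in>{..Suc n}. f (grid_point a b n j) \<le> f (grid_point a b n i))", OF this]
  have "grid_argmax a b f n \<le> Suc n \<and> (\<forall>j\<in>{..Suc n}. f (grid_point a b n j) \<le> f (grid_point a b n (grid_argmax a b f n)))"
    unfolding grid_argmax_def .
  then show "grid_argmax a b f n \<le> Suc n"
    "j \<le> Suc n \<Longrightarrow> f (grid_point a b n j) \<le> f (grid_point a b n (grid_argmax a b f n))" by auto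
qed

text \<open>
  Outside any neighbourhood of \<open>s\<close> the values of \<open>f\<close> stay below \<open>f s\<close> by a fixed amount, while the grid maxima
  converge to \<open>f s\<close>.
\<close>

lemma argmax_lim_eq:
  fixes f :: "real \<Rightarrow> real"
  assumes ab: "a < b" and cont: "continuous_on {a..b} f" and s: "s \<in> {a..b}"
    and max: "\<And>r. r \<in> {a..b} \<Longrightarrow> r \<noteq> s \<Longrightarrow> f r < f s"
  shows "argmax_lim a b f = s"
proof -
  define y where "y n = grid_point a b n (grid_argmax a b f n)" for n
  have yab: "y n \<in> {a..b}" for n
    unfolding y_def using ab by (intro grid_point_in_interval grid_argmax) auto
  obtain i where i: "\<And>n. i n \<le> Suc n" "(\<lambda>n. grid_point a b n (i n)) \<longlonglongrightarrow> s"
    using nearest_grid_point[OF ab s] by blast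
  have pab: "grid_point a b n (i n) \<in> {a..b}" for n
    using ab i(1) by (intro grid_point_in_interval) auto
  have lower: "(\<lambda>n. f (grid_point a b n (i n))) \<longlonglongrightarrow> f s"
    by (rule continuous_on_tendsto_compose[OF cont _ s]) (use i pab in auto)
  have fy: "(\<lambda>n. f (y n)) \<longlonglongrightarrow> f s"
  proof (rule real_tendsto_sandwich[OF _ _ lower tendsto_const])
    show "\<forall>\<^sub>F n in sequentially. f (grid_point a b n (i n)) \<le> f (y n)"
      unfolding y_def by (intro always_eventually allI grid_argmax(2)[OF i(1)])
    have "f (y n) \<le> f s" for n using max[OF yab[of n]] by (cases "y n = s") auto
    then show "\<forall>\<^sub>F n in sequentially. f (y n) \<le> f s" by (intro always_eventually allI)
  qed
  have "y \<longlonglongrightarrow> s"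
  proof (rule tendstoI)
    fix e :: real assume e: "0 < e"
    let ?K = "{a..b} - ball s e"
    show "\<forall>\<^sub>F n in sequentially. dist (y n) s < e"
    proof (cases "?K = {}")
      case True
      then have "y n \<in> ball s e" for n using yab by blast
      then show ?thesis by (simp add: dist_commute)
    next
      case False
      have "compact ?K" by (intro compact_diff) auto
      then obtain r where r: "r \<in> ?K" "\<And>z. z \<in> ?K \<Longrightarrow> f z \<le> f r"
        using continuous_attains_sup[OF _ False continuous_on_subset[OF cont Diff_subset]] by blast
      have "r \<noteq> s" using r(1) e by auto
      then have "f r < f s" using r(1) by (intro max) auto
      then have "\<forall>\<^sub>F n in sequentially. f r < f (y n)" using fy by (simp add: order_tendstoD)
      then show ?thesis
      proof (rule eventually_mono)
        fix n assume "f r < f (y n)"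
        then have "y n \<notin> ?K" using r(2)[of "y n"] by linarith
        then show "dist (y n) s < e" using yab by (simp add: dist_commute)
      qed
    qed
  qed
  then show ?thesis unfolding argmax_lim_def y_def by (rule limI)
qed

lemma argmax_lim_measurable:
  assumes ab: "0 \<le> a" "a \<le> b"
  shows "(\<lambda>f. argmax_lim a b (\<lambda>r. \<phi> r + \<sigma> * f r)) \<in> borel_measurable (Pi\<^sub>M {0..} (\<lambda>_. borel))"
  unfolding argmax_lim_def
proof (rule borel_measurable_lim_metric)
  fix n
  have c: "(\<lambda>f. f (grid_point a b n j)) \<in> borel_measurable (Pi\<^sub>M {0..} (\<lambda>_. borel))" if "j \<le> Suc n" for j
    using grid_point_in_interval[OF ab(2) that] ab by (intro measurable_component_singleton) auto
  have "Measurable.pred (Pi\<^sub>M {0..} (\<lambda>_. borel)) (\<lambda>f. i \<le> Suc n \<and> (\<forall>j\<in>{..Suc n}.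
      \<phi> (grid_point a b n j) + \<sigma> * f (grid_point a b n j) \<le> \<phi> (grid_point a b n i) + \<sigma> * f (grid_point a b n i)))" for i
  proof (cases "i \<le> Suc n")
    case True
    have "Measurable.pred (Pi\<^sub>M {0..} (\<lambda>_. borel)) (\<lambda>f. \<forall>j\<in>{..Suc n}.
      \<phi> (grid_point a b n j) + \<sigma> * f (grid_point a b n j) \<le> \<phi> (grid_point a b n i) + \<sigma> * f (grid_point a b n i))"
    proof (rule pred_intros_finite)
      fix j assume "j \<in> {..Suc n}"
      then have "j \<le> Suc n" by simp
      note cj = c[OF this] and ci = c[OF True]
      show "Measurable.pred (Pi\<^sub>M {0..} (\<lambda>_. borel)) (\<lambda>f.
        \<phi> (grid_point a b n j) + \<sigma> * f (grid_point a b n j) \<le> \<phi> (grid_point a b n i) + \<sigma> * f (grid_point a b n i))"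
        unfolding pred_def
        by (intro borel_measurable_le borel_measurable_add borel_measurable_times borel_measurable_const ci cj)
    qed simp
    then show ?thesis using True by simp
  qed simp
  then have [measurable]: "(\<lambda>f. grid_argmax a b (\<lambda>r. \<phi> r + \<sigma> * f r) n) \<in> measurable (Pi\<^sub>M {0..} (\<lambda>_. borel)) (count_space UNIV)"
    unfolding grid_argmax_def by (rule measurable_Least)
  show "(\<lambda>f. grid_point a b n (grid_argmax a b (\<lambda>r. \<phi> r + \<sigma> * f r) n)) \<in> borel_measurable (Pi\<^sub>M {0..} (\<lambda>_. borel))"
    unfolding grid_point_def by measurable
qed

context prob_space
begin

text \<open>
  For a frozen path \<open>f\<close> of \<open>W1\<close>, the time \<open>\<tau> f\<close> and the set of scales \<open>{k. Q k f}\<close> are deterministic, so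
  \<open>infinitely_often_large_increment\<close> applies to \<open>W2\<close>; then \<open>f\<close> is integrated out.
\<close>

lemma large_increment_at_independent_time:
  assumes W2: "standard_brownian_motion W2" and ind: "indep_processes {0..} W1 W2"
    and \<tau>: "\<tau> \<in> borel_measurable (Pi\<^sub>M {0..} (\<lambda>_. borel))" "\<And>f. 0 \<le> \<tau> f"
    and Q: "\<And>k. Measurable.pred (Pi\<^sub>M {0..} (\<lambda>_. borel)) (Q k)" and c: "c \<noteq> 0"
  shows "AE \<omega> in M. (\<exists>\<^sub>\<infinity>k. Q k (\<lambda>t\<in>{0..}. W1 t \<omega>)) \<longrightarrow>
    (\<exists>\<^sub>\<infinity>k. Q k (\<lambda>t\<in>{0..}. W1 t \<omega>) \<and>
      L * (1/2) ^ k < c * (W2 (\<tau> (\<lambda>t\<in>{0..}. W1 t \<omega>) + (1/4) ^ k) \<omega> - W2 (\<tau> (\<lambda>t\<in>{0..}. W1 t \<omega>)) \<omega>))"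
proof -
  let ?P = "Pi\<^sub>M {0..} (\<lambda>_. borel) :: (real \<Rightarrow> real) measure"
  let ?w1 = "\<lambda>\<omega>. \<lambda>t\<in>{0..}. W1 t \<omega>" and ?w2 = "\<lambda>\<omega>. \<lambda>t\<in>{0..}. W2 t \<omega>"
  define bad where "bad f g \<longleftrightarrow> (\<exists>\<^sub>\<infinity>k. Q k f) \<and> \<not> (\<exists>\<^sub>\<infinity>k. Q k f \<and>
      L * (1/2) ^ k < c * (eval_lim g (\<tau> f + (1/4) ^ k) - eval_lim g (\<tau> f)))" for f g
  define A where "A = {p \<in> space (?P \<Otimes>\<^sub>M ?P). bad (fst p) (snd p)}"
  have ind': "indep_var ?P ?w1 ?P ?w2" using ind by (simp add: indep_processes_def)
  have [measurable]: "Measurable.pred (?P \<Otimes>\<^sub>M ?P) (\<lambda>p. Q k (fst p))" for k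
    by (rule measurable_compose[OF measurable_fst Q])
  have tm: "(\<lambda>p. \<tau> (fst p)) \<in> borel_measurable (?P \<Otimes>\<^sub>M ?P)"
    by (rule measurable_compose[OF measurable_fst \<tau>(1)])
  have [measurable]: "(\<lambda>p. eval_lim (snd p) (\<tau> (fst p))) \<in> borel_measurable (?P \<Otimes>\<^sub>M ?P)"
    by (rule eval_lim_measurable[OF measurable_snd tm])
  have [measurable]: "(\<lambda>p. eval_lim (snd p) (\<tau> (fst p) + (1/4) ^ k)) \<in> borel_measurable (?P \<Otimes>\<^sub>M ?P)" for k
    using tm by (intro eval_lim_measurable[OF measurable_snd] borel_measurable_add borel_measurable_const)
  have A: "A \<in> sets (?P \<Otimes>\<^sub>M ?P)"
    unfolding A_def bad_def INFM_nat_le by measurable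
  \<comment> \<open>On the continuous paths that occur, the measurable substitute is honest evaluation.\<close>
  have ev: "eval_lim (?w2 \<omega>) t = W2 t \<omega>" if "\<omega> \<in> space M" "0 \<le> t" for \<omega> t
    by (rule eval_lim_eq[OF standard_brownian_motion_continuous[OF W2 that(1)] that(2)])
  have "emeasure M {\<omega>\<in>space M. (f, ?w2 \<omega>) \<in> A} \<le> 0" if f: "f \<in> space ?P" for f
  proof -
    have "AE \<omega> in M. \<not> bad f (?w2 \<omega>)"
    proof (cases "\<exists>\<^sub>\<infinity>k. Q k f")
      case True
      then have "infinite {k. Q k f}" by (simp add: INFM_iff_infinite)
      from infinitely_often_large_increment[OF W2 \<tau>(2) this c, of L f]
      show ?thesis using AE_space
      proof eventually_elim
        case (elim \<omega>)
        then show ?case using \<tau>(2)[of f] by (simp add: bad_def ev)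
      qed
    qed (simp add: bad_def)
    then have "AE \<omega> in M. (f, ?w2 \<omega>) \<notin> A" by (rule AE_mp) (simp add: A_def)
    then show ?thesis by (simp add: emeasure_eq_0_AE)
  qed
  then have "emeasure M {\<omega>\<in>space M. (?w1 \<omega>, ?w2 \<omega>) \<in> A} \<le> 0"
    by (rule indep_var_section_bound[OF ind' A])
  moreover have m: "?w1 \<in> measurable M ?P" "?w2 \<in> measurable M ?P"
    using indep_var_rv1[OF ind'] indep_var_rv2[OF ind'] by simp_all
  then have "{\<omega>\<in>space M. (?w1 \<omega>, ?w2 \<omega>) \<in> A} \<in> events"
    using measurable_sets[OF measurable_Pair[OF m] A] by (simp add: vimage_def Int_def conj_commute)
  ultimately have "AE \<omega> in M. (?w1 \<omega>, ?w2 \<omega>) \<notin> A"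
    by (intro AE_I[of _ _ "{\<omega>\<in>space M. (?w1 \<omega>, ?w2 \<omega>) \<in> A}"]) auto
  then show ?thesis
  proof (rule AE_mp, intro AE_I2 impI)
    fix \<omega> assume \<omega>: "\<omega> \<in> space M" and nA: "(?w1 \<omega>, ?w2 \<omega>) \<notin> A" and inf: "\<exists>\<^sub>\<infinity>k. Q k (?w1 \<omega>)"
    have sp: "(?w1 \<omega>, ?w2 \<omega>) \<in> space (?P \<Otimes>\<^sub>M ?P)"
      unfolding space_pair_measure
      by (rule SigmaI[OF measurable_space[OF m(1) \<omega>] measurable_space[OF m(2) \<omega>]])
    have "(?w1 \<omega>, ?w2 \<omega>) \<in> A" if b: "bad (?w1 \<omega>) (?w2 \<omega>)"
      unfolding A_def by (rule CollectI, rule conjI[OF sp]) (simp only: fst_conv snd_conv b)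
    with nA have nbad: "\<not> bad (?w1 \<omega>) (?w2 \<omega>)" by (rule contrapos_nn)
    have t0: "0 \<le> \<tau> (?w1 \<omega>)" by (rule \<tau>(2))
    then have tk: "0 \<le> \<tau> (?w1 \<omega>) + (1/4) ^ k" for k by simp
    from nbad inf show "\<exists>\<^sub>\<infinity>k. Q k (?w1 \<omega>) \<and>
        L * (1/2) ^ k < c * (W2 (\<tau> (?w1 \<omega>) + (1/4) ^ k) \<omega> - W2 (\<tau> (?w1 \<omega>)) \<omega>)"
      unfolding bad_def ev[OF \<omega> t0] ev[OF \<omega> tk] by blast
  qed
qed

end

section \<open>Common local maxima\<close>

lemma half_Hoelder_continuous:
  fixes f :: "real \<Rightarrow> real"
  assumes "\<And>s t. \<bar>f t - f s\<bar> \<le> H * sqrt \<bar>t - s\<bar>"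
  shows "continuous_on A f"
proof (rule continuous_at_imp_continuous_on, rule ballI)
  fix x
  have "((\<lambda>t. H * sqrt \<bar>t - x\<bar>) \<longlongrightarrow> H * sqrt \<bar>x - x\<bar>) (at x)"
    by (intro tendsto_intros)
  then have "((\<lambda>t. H * sqrt \<bar>t - x\<bar>) \<longlongrightarrow> 0) (at x)" by simp
  then have "((\<lambda>t. f t - f x) \<longlongrightarrow> 0) (at x)"
    by (rule Lim_null_comparison[rotated]) (use assms in \<open>auto intro!: always_eventually\<close>)
  then show "isCont f x" unfolding isCont_def by (rule LIM_zero_cancel)
qed

lemma is_local_max_reflect:
  assumes "is_local_max f t"
  shows "is_local_max (\<lambda>s. f (- s)) (- t)"
proof -
  obtain \<eta> where \<eta>: "\<eta> > 0" "\<And>s. s \<in> {t - \<eta><..<t + \<eta>} \<Longrightarrow> f s \<le> f t"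
    using assms unfolding is_local_max_def by blast
  have "f (- s) \<le> f (- (- t))" if "s \<in> {- t - \<eta><..<- t + \<eta>}" for s
    using \<eta>(2)[of "- s"] that by auto
  then show ?thesis unfolding is_local_max_def using \<eta>(1) by blast
qed

lemma is_local_max_dyadic:
  assumes "is_local_max f t"
  shows "\<exists>k0. \<forall>k\<ge>k0. f (t + (1/4) ^ k) \<le> f t"
proof -
  obtain \<eta> where \<eta>: "\<eta> > 0" "\<And>s. s \<in> {t - \<eta><..<t + \<eta>} \<Longrightarrow> f s \<le> f t"
    using assms unfolding is_local_max_def by blast
  obtain k0 where k0: "(1/4) ^ k0 < \<eta>" using real_arch_pow_inv[OF \<eta>(1), of "1/4"] by auto
  have "f (t + (1/4) ^ k) \<le> f t" if "k0 \<le> k" for k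
  proof (rule \<eta>(2))
    have "(1/4::real) ^ k \<le> (1/4) ^ k0" using that by (intro power_decreasing) auto
    moreover have "(0::real) < (1/4) ^ k" by simp
    ultimately have "t - \<eta> < t + (1/4) ^ k" "t + (1/4) ^ k < t + \<eta>" using k0 \<eta>(1) by linarith+
    then show "t + (1/4) ^ k \<in> {t - \<eta><..<t + \<eta>}" by simp
  qed
  then show ?thesis by blast
qed

lemma half_Hoelder_dyadic:
  fixes f :: "real \<Rightarrow> real"
  assumes "\<And>s t. \<bar>f t - f s\<bar> \<le> H * sqrt \<bar>t - s\<bar>"
  shows "\<bar>f (t + (1/4) ^ k) - f t\<bar> \<le> H * (1/2) ^ k"
proof -
  have "sqrt \<bar>t + (1/4) ^ k - t\<bar> = (1/2) ^ k" by (simp add: real_sqrt_power real_sqrt_divide)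
  then show ?thesis using assms[of "t + (1/4) ^ k" t] by simp
qed

text \<open>
  A second maximum point in a small rational interval around \<open>t\<close> could be separated from \<open>t\<close> by two rational
  points, which would give two disjoint intervals with equal maxima.
\<close>

lemma local_max_is_argmax_lim:
  fixes f :: "real \<Rightarrow> real"
  assumes cont: "continuous_on {0..} f" and t: "0 < t" and lm: "is_local_max f t"
    and distinct: "\<And>a b c d. a \<in> \<rat> \<Longrightarrow> b \<in> \<rat> \<Longrightarrow> c \<in> \<rat> \<Longrightarrow> d \<in> \<rat> \<Longrightarrow> 0 \<le> a \<Longrightarrow> a < b \<Longrightarrow> b < c \<Longrightarrow> c < d \<Longrightarrow>
      \<not> (\<exists>s\<in>{a..b}. \<exists>s'\<in>{c..d}. f s = f s' \<and> (\<forall>r\<in>{a..b}. f r \<le> f s) \<and> (\<forall>r\<in>{c..d}. f r \<le> f s'))"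
  obtains a b where "a \<in> \<rat>" "b \<in> \<rat>" "0 \<le> a" "a < b" "argmax_lim a b f = t"
proof -
  obtain \<eta> where \<eta>: "\<eta> > 0" "\<And>s. s \<in> {t - \<eta><..<t + \<eta>} \<Longrightarrow> f s \<le> f t"
    using lm unfolding is_local_max_def by blast
  have "max 0 (t - \<eta>) < t" using t \<eta>(1) by simp
  then obtain a where a: "a \<in> \<rat>" "max 0 (t - \<eta>) < a" "a < t" using Rats_dense_in_real by blast
  obtain b where b: "b \<in> \<rat>" "t < b" "b < t + \<eta>" using Rats_dense_in_real[of t "t + \<eta>"] \<eta>(1) by auto
  have a0: "0 \<le> a" "t - \<eta> < a" using a(2) by auto
  have le: "f r \<le> f t" if "r \<in> {a..b}" for r
    using that a0(2) b(3) by (intro \<eta>(2)) auto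
  have less: "f r < f t" if r: "r \<in> {a..b}" "r \<noteq> t" for r
  proof (rule ccontr)
    assume "\<not> f r < f t"
    then have eq: "f r = f t" using le[OF r(1)] by linarith
    define u v where "u = min r t" and "v = max r t"
    have uv: "u < v" "a \<le> u" "v \<le> b" "f u = f t" "f v = f t"
      using r a(3) b(2) eq by (auto simp: u_def v_def min_def max_def)
    obtain q where q: "q \<in> \<rat>" "u < q" "q < v" using Rats_dense_in_real[OF uv(1)] by blast
    obtain q' where q': "q' \<in> \<rat>" "q < q'" "q' < v" using Rats_dense_in_real[OF q(3)] by blast
    have "\<exists>s\<in>{a..q}. \<exists>s'\<in>{q'..b}. f s = f s' \<and> (\<forall>r\<in>{a..q}. f r \<le> f s) \<and> (\<forall>r\<in>{q'..b}. f r \<le> f s')"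
    proof (rule bexI[of _ u], rule bexI[of _ v], intro conjI ballI)
      show "f x \<le> f u" if "x \<in> {a..q}" for x using that le[of x] q q' uv by auto
      show "f x \<le> f v" if "x \<in> {q'..b}" for x using that le[of x] q q' uv by auto
    qed (use q q' uv in auto)
    moreover have "a < q" "q' < b" using q q' uv by linarith+
    ultimately show False using distinct[OF a(1) q(1) q'(1) b(1) a0(1) _ q'(2)] by blast
  qed
  have "argmax_lim a b f = t"
  proof (rule argmax_lim_eq)
    show "continuous_on {a..b} f" using cont by (rule continuous_on_subset) (use a0 in auto)
  qed (use a b less in auto)
  then show thesis using that[of a b] a b a0 by simp
qed

context prob_space
begin

text \<open>
  The choice \<open>L = H2 + 43 * \<bar>\<rho>1\<bar>\<close> is what \<open>\<phi>2\<close> and \<open>\<rho>1 * W1\<close> can contribute at a scale where the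
  increment of \<open>W1\<close> is small. At a common local maximum the increment of \<open>\<rho>2 * W2\<close> would therefore be at
  most \<open>L * 2^-k\<close> at all good scales beyond some \<open>k0\<close>.
\<close>

lemma no_common_local_max_positive_time:
  assumes W1: "standard_brownian_motion W1" and W2: "standard_brownian_motion W2"
    and ind: "indep_processes {0..} W1 W2"
    and H1: "\<And>s t. \<bar>\<phi>1 t - \<phi>1 s\<bar> \<le> H1 * sqrt \<bar>t - s\<bar>"
    and H2: "\<And>s t. \<bar>\<phi>2 t - \<phi>2 s\<bar> \<le> H2 * sqrt \<bar>t - s\<bar>"
    and \<sigma>: "\<sigma> \<noteq> 0" and \<rho>2: "\<rho>2 \<noteq> 0"
  shows "AE \<omega> in M. \<forall>t>0. is_local_max (\<lambda>s. \<phi>1 s + \<sigma> * W1 s \<omega>) t \<longrightarrow>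
    \<not> is_local_max (\<lambda>s. \<phi>2 s + \<rho>1 * W1 s \<omega> + \<rho>2 * W2 s \<omega>) t"
proof -
  let ?P = "Pi\<^sub>M {0..} (\<lambda>_. borel) :: (real \<Rightarrow> real) measure"
  let ?w1 = "\<lambda>\<omega>. \<lambda>t\<in>{0..}. W1 t \<omega>"
  have c1: "continuous_on A \<phi>1" for A using H1 by (rule half_Hoelder_continuous)
  define L where "L = H2 + \<bar>\<rho>1\<bar> * 43"
  \<comment> \<open>Where argmax_lim does not converge its value is arbitrary; the maximum with 0 keeps it a legal time.\<close>
  define \<tau> where "\<tau> a b f = max 0 (argmax_lim a b (\<lambda>r. \<phi>1 r + \<sigma> * f r))" for a b f
  define Q where "Q a b k f \<longleftrightarrow> \<bar>eval_lim f (\<tau> a b f + (1/4) ^ k) - eval_lim f (\<tau> a b f)\<bar> < 43 * (1/2) ^ k"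
    for a b k f
  have \<tau>m: "\<tau> a b \<in> borel_measurable ?P" if "0 \<le> a" "a \<le> b" for a b
    unfolding \<tau>_def by (intro borel_measurable_max borel_measurable_const argmax_lim_measurable that)
  have Qm: "Measurable.pred ?P (Q a b k)" if "0 \<le> a" "a \<le> b" for a b k
    unfolding Q_def pred_def
    by (intro borel_measurable_less borel_measurable_abs borel_measurable_diff eval_lim_measurable
        measurable_ident_sets refl borel_measurable_add \<tau>m that borel_measurable_const)
  have "AE \<omega> in M. \<forall>a\<in>\<rat>. \<forall>b\<in>\<rat>. 0 \<le> a \<longrightarrow> a < b \<longrightarrow> (\<exists>\<^sub>\<infinity>k. Q a b k (?w1 \<omega>)) \<longrightarrow>
      (\<exists>\<^sub>\<infinity>k. Q a b k (?w1 \<omega>) \<and>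
        L * (1/2) ^ k < \<rho>2 * (W2 (\<tau> a b (?w1 \<omega>) + (1/4) ^ k) \<omega> - W2 (\<tau> a b (?w1 \<omega>)) \<omega>))"
  proof (simp only: AE_ball_countable[OF countable_rat], intro ballI)
    fix a b :: real
    show "AE \<omega> in M. 0 \<le> a \<longrightarrow> a < b \<longrightarrow> (\<exists>\<^sub>\<infinity>k. Q a b k (?w1 \<omega>)) \<longrightarrow>
      (\<exists>\<^sub>\<infinity>k. Q a b k (?w1 \<omega>) \<and>
        L * (1/2) ^ k < \<rho>2 * (W2 (\<tau> a b (?w1 \<omega>) + (1/4) ^ k) \<omega> - W2 (\<tau> a b (?w1 \<omega>)) \<omega>))"
    proof (cases "0 \<le> a \<and> a < b")
      case True
      then have ab: "0 \<le> a" "a \<le> b" by auto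
      have "0 \<le> \<tau> a b f" for f by (simp add: \<tau>_def)
      from large_increment_at_independent_time[where Q="Q a b" and \<tau>="\<tau> a b", OF W2 ind \<tau>m[OF ab] this Qm[OF ab] \<rho>2, where L=L]
      show ?thesis by (rule AE_mp) simp
    qed auto
  qed
  moreover have "AE \<omega> in M. \<forall>t\<ge>0. \<exists>\<^sub>\<infinity>k. \<bar>W1 (t + (1/4) ^ k) \<omega> - W1 t \<omega>\<bar> < 43 * (1/2) ^ k"
    by (rule infinitely_many_small_increments_everywhere[OF W1])
  moreover have "AE \<omega> in M. \<forall>a\<in>\<rat>. \<forall>b\<in>\<rat>. \<forall>c\<in>\<rat>. \<forall>d\<in>\<rat>. 0 \<le> a \<longrightarrow> a < b \<longrightarrow> b < c \<longrightarrow> c < d \<longrightarrow>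
      \<not> (\<exists>s\<in>{a..b}. \<exists>s'\<in>{c..d}. \<phi>1 s + \<sigma> * W1 s \<omega> = \<phi>1 s' + \<sigma> * W1 s' \<omega> \<and>
        (\<forall>r\<in>{a..b}. \<phi>1 r + \<sigma> * W1 r \<omega> \<le> \<phi>1 s + \<sigma> * W1 s \<omega>) \<and>
        (\<forall>r\<in>{c..d}. \<phi>1 r + \<sigma> * W1 r \<omega> \<le> \<phi>1 s' + \<sigma> * W1 s' \<omega>))"
  proof (simp only: AE_ball_countable[OF countable_rat], intro ballI)
    fix a b c d :: real
    show "AE \<omega> in M. 0 \<le> a \<longrightarrow> a < b \<longrightarrow> b < c \<longrightarrow> c < d \<longrightarrow>
      \<not> (\<exists>s\<in>{a..b}. \<exists>s'\<in>{c..d}. \<phi>1 s + \<sigma> * W1 s \<omega> = \<phi>1 s' + \<sigma> * W1 s' \<omega> \<and>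
        (\<forall>r\<in>{a..b}. \<phi>1 r + \<sigma> * W1 r \<omega> \<le> \<phi>1 s + \<sigma> * W1 s \<omega>) \<and>
        (\<forall>r\<in>{c..d}. \<phi>1 r + \<sigma> * W1 r \<omega> \<le> \<phi>1 s' + \<sigma> * W1 s' \<omega>))"
    proof (cases "0 \<le> a \<and> a < b \<and> b < c \<and> c < d")
      case True
      then have "0 \<le> a" "a < b" "b < c" "c < d" by auto
      from no_equal_maxima_on_disjoint_intervals[OF W1 \<sigma> c1 this]
      show ?thesis by (rule AE_mp) (intro AE_I2 impI)
    qed auto
  qed
  ultimately show ?thesis using AE_space
  proof eventually_elim
    case (elim \<omega>)
    let ?X1 = "\<lambda>s. \<phi>1 s + \<sigma> * W1 s \<omega>"
    show ?case
    proof (intro allI impI notI)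
      fix t :: real
      assume t: "0 < t" and lm1: "is_local_max ?X1 t"
        and lm2: "is_local_max (\<lambda>s. \<phi>2 s + \<rho>1 * W1 s \<omega> + \<rho>2 * W2 s \<omega>) t"
      have cW1: "continuous_on {0..} (\<lambda>s. W1 s \<omega>)"
        by (rule standard_brownian_motion_continuous[OF W1 elim(4)])
      have cX1: "continuous_on {0..} ?X1" by (intro continuous_intros c1 cW1)
      obtain a b where ab: "a \<in> \<rat>" "b \<in> \<rat>" "0 \<le> a" "a < b" "argmax_lim a b ?X1 = t"
        by (rule local_max_is_argmax_lim[OF cX1 t lm1 elim(3)[rule_format]])
      have "argmax_lim a b (\<lambda>r. \<phi>1 r + \<sigma> * (?w1 \<omega>) r) = argmax_lim a b ?X1"
      proof -
        have g: "grid_point a b n j \<in> {0..}" if "j \<le> Suc n" for n j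
          using grid_point_in_interval[of a b j n] that ab by auto
        have "grid_argmax a b (\<lambda>r. \<phi>1 r + \<sigma> * (?w1 \<omega>) r) = grid_argmax a b ?X1"
          unfolding grid_argmax_def using g by (intro ext arg_cong[where f=Least]) (auto simp: restrict_def)
        then show ?thesis unfolding argmax_lim_def by simp
      qed
      then have \<tau>: "\<tau> a b (?w1 \<omega>) = t" using ab(5) t by (simp add: \<tau>_def)
      have e: "eval_lim (?w1 \<omega>) s = W1 s \<omega>" if "0 \<le> s" for s by (rule eval_lim_eq[OF cW1 that])
      have t0: "0 \<le> t" and tk: "0 \<le> t + (1/4) ^ k" for k using t by (auto simp: add_nonneg_nonneg)
      have Q: "Q a b k (?w1 \<omega>) \<longleftrightarrow> \<bar>W1 (t + (1/4) ^ k) \<omega> - W1 t \<omega>\<bar> < 43 * (1/2) ^ k" for k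
        unfolding Q_def \<tau> e[OF t0] e[OF tk] ..
      have infQ: "\<exists>\<^sub>\<infinity>k. Q a b k (?w1 \<omega>)" unfolding Q by (rule elim(2)[rule_format, OF t0])
      from elim(1)[rule_format, OF ab(1,2,3,4) infQ]
      have inf: "\<exists>\<^sub>\<infinity>k. \<bar>W1 (t + (1/4) ^ k) \<omega> - W1 t \<omega>\<bar> < 43 * (1/2) ^ k \<and>
          L * (1/2) ^ k < \<rho>2 * (W2 (t + (1/4) ^ k) \<omega> - W2 t \<omega>)"
        unfolding \<tau> Q .
      obtain k0 where k0: "\<forall>k\<ge>k0. \<phi>2 (t + (1/4) ^ k) + \<rho>1 * W1 (t + (1/4) ^ k) \<omega> + \<rho>2 * W2 (t + (1/4) ^ k) \<omega>
          \<le> \<phi>2 t + \<rho>1 * W1 t \<omega> + \<rho>2 * W2 t \<omega>"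
        using is_local_max_dyadic[OF lm2] by (rule exE)
      obtain k where k: "k0 \<le> k" "\<bar>W1 (t + (1/4) ^ k) \<omega> - W1 t \<omega>\<bar> < 43 * (1/2) ^ k"
          "L * (1/2) ^ k < \<rho>2 * (W2 (t + (1/4) ^ k) \<omega> - W2 t \<omega>)"
        using inf[unfolded INFM_nat_le, rule_format, of k0] by blast
      have "\<bar>\<rho>1 * (W1 (t + (1/4) ^ k) \<omega> - W1 t \<omega>)\<bar> \<le> \<bar>\<rho>1\<bar> * (43 * (1/2) ^ k)"
        unfolding abs_mult using k(2) by (intro mult_left_mono) auto
      moreover have "\<bar>\<phi>2 (t + (1/4) ^ k) - \<phi>2 t\<bar> \<le> H2 * (1/2) ^ k"
        using H2 by (rule half_Hoelder_dyadic)
      moreover have "L * (1/2) ^ k = H2 * (1/2) ^ k + \<bar>\<rho>1\<bar> * (43 * (1/2) ^ k)"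
        by (simp only: L_def distrib_right mult.assoc)
      moreover have "\<rho>2 * (W2 (t + (1/4) ^ k) \<omega> - W2 t \<omega>) = \<rho>2 * W2 (t + (1/4) ^ k) \<omega> - \<rho>2 * W2 t \<omega>"
        "\<rho>1 * (W1 (t + (1/4) ^ k) \<omega> - W1 t \<omega>) = \<rho>1 * W1 (t + (1/4) ^ k) \<omega> - \<rho>1 * W1 t \<omega>"
        by (simp_all only: right_diff_distrib)
      ultimately show False using k0[rule_format, OF k(1)] k(3) by linarith
    qed
  qed
qed

lemma zero_not_local_max:
  assumes W: "standard_brownian_motion W"
    and H: "\<And>s t. \<bar>\<phi> t - \<phi> s\<bar> \<le> H * sqrt \<bar>t - s\<bar>" and \<sigma>: "\<sigma> \<noteq> 0"
  shows "AE \<omega> in M. \<not> is_local_max (\<lambda>s. \<phi> s + \<sigma> * W s \<omega>) 0"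
proof -
  have "AE \<omega> in M. \<exists>\<^sub>\<infinity>k. k \<in> UNIV \<and> H * (1/2) ^ k < \<sigma> * (W (0 + (1/4) ^ k) \<omega> - W 0 \<omega>)"
    by (rule infinitely_often_large_increment[OF W order_refl infinite_UNIV_nat \<sigma>])
  then show ?thesis
  proof eventually_elim
    case (elim \<omega>)
    show ?case
    proof
      assume "is_local_max (\<lambda>s. \<phi> s + \<sigma> * W s \<omega>) 0"
      then have "\<exists>k0. \<forall>k\<ge>k0. \<phi> (0 + (1/4) ^ k) + \<sigma> * W (0 + (1/4) ^ k) \<omega> \<le> \<phi> 0 + \<sigma> * W 0 \<omega>"
        by (rule is_local_max_dyadic)
      then obtain k0 where k0: "\<forall>k\<ge>k0. \<phi> (0 + (1/4) ^ k) + \<sigma> * W (0 + (1/4) ^ k) \<omega> \<le> \<phi> 0 + \<sigma> * W 0 \<omega>"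
        by (rule exE)
      obtain k where k: "k0 \<le> k" "H * (1/2) ^ k < \<sigma> * (W (0 + (1/4) ^ k) \<omega> - W 0 \<omega>)"
        using elim unfolding INFM_nat_le by blast
      have "\<bar>\<phi> (0 + (1/4) ^ k) - \<phi> 0\<bar> \<le> H * (1/2) ^ k" using H by (rule half_Hoelder_dyadic)
      moreover have "\<sigma> * (W (0 + (1/4) ^ k) \<omega> - W 0 \<omega>) = \<sigma> * W (0 + (1/4) ^ k) \<omega> - \<sigma> * W 0 \<omega>"
        by (simp only: right_diff_distrib)
      ultimately show False using k0[rule_format, OF k(1)] k(2) by linarith
    qed
  qed
qed

lemma indep_processes_time_change:
  assumes ind: "indep_processes UNIV X Y"
  shows "indep_processes T (\<lambda>t. X (\<theta> t)) (\<lambda>t. Y (\<theta> t))"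
proof -
  have m: "(\<lambda>f. \<lambda>t\<in>T. f (\<theta> t)) \<in> measurable (Pi\<^sub>M UNIV (\<lambda>_. borel)) (Pi\<^sub>M T (\<lambda>_. borel :: real measure))"
    by (intro measurable_restrict measurable_component_singleton) simp
  have "indep_var (Pi\<^sub>M T (\<lambda>_. borel)) ((\<lambda>f. \<lambda>t\<in>T. f (\<theta> t)) \<circ> (\<lambda>\<omega>. \<lambda>t\<in>UNIV. X t \<omega>))
      (Pi\<^sub>M T (\<lambda>_. borel)) ((\<lambda>f. \<lambda>t\<in>T. f (\<theta> t)) \<circ> (\<lambda>\<omega>. \<lambda>t\<in>UNIV. Y t \<omega>))"
    using ind[unfolded indep_processes_def] m m by (rule indep_var_compose)
  then show ?thesis by (simp add: indep_processes_def comp_def)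
qed

end

theorem theorem1p1:
  fixes M :: "'a measure"
    and B1 B2 X1 X2 :: "real \<Rightarrow> 'a \<Rightarrow> real"
    and \<phi>1 \<phi>2 :: "real \<Rightarrow> real"
    and \<sigma> \<rho>1 \<rho>2 :: real
  assumes "prob_space M"
    and "prob_space.two_sided_brownian_motion M B1"
    and "prob_space.two_sided_brownian_motion M B2"
    and "prob_space.indep_processes M UNIV B1 B2"
    and "has_L2_derivative \<phi>1" and "has_L2_derivative \<phi>2"
    and "\<sigma> \<noteq> 0" and "\<rho>2 \<noteq> 0"
    and "\<And>t \<omega>. X1 t \<omega> = \<phi>1 t + \<sigma> * B1 t \<omega>"
    and "\<And>t \<omega>. X2 t \<omega> = \<phi>2 t + \<rho>1 * B1 t \<omega> + \<rho>2 * B2 t \<omega>"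
  shows "AE \<omega> in M. \<not> (\<exists>t. is_local_max (\<lambda>s. X1 s \<omega>) t \<and> is_local_max (\<lambda>s. X2 s \<omega>) t)"
proof -
  interpret prob_space M by fact
  note ind = \<open>indep_processes UNIV B1 B2\<close>
  have W: "standard_brownian_motion B1" "standard_brownian_motion (\<lambda>t. B1 (- t))"
    "standard_brownian_motion B2" "standard_brownian_motion (\<lambda>t. B2 (- t))"
    using assms(2,3) by (simp_all only: two_sided_brownian_motion_def)
  obtain H1 where H1: "\<And>s t. \<bar>\<phi>1 t - \<phi>1 s\<bar> \<le> H1 * sqrt \<bar>t - s\<bar>"
    using has_L2_derivative_half_Hoelder[OF assms(5)] by metis
  obtain H2 where H2: "\<And>s t. \<bar>\<phi>2 t - \<phi>2 s\<bar> \<le> H2 * sqrt \<bar>t - s\<bar>"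
    using has_L2_derivative_half_Hoelder[OF assms(6)] by metis
  \<comment> \<open>The reflected drifts satisfy the same Hoelder bounds.\<close>
  have R1: "\<bar>\<phi>1 (- t) - \<phi>1 (- s)\<bar> \<le> H1 * sqrt \<bar>t - s\<bar>" for s t
    using H1[of "- t" "- s"] by (simp add: abs_minus_commute)
  have R2: "\<bar>\<phi>2 (- t) - \<phi>2 (- s)\<bar> \<le> H2 * sqrt \<bar>t - s\<bar>" for s t
    using H2[of "- t" "- s"] by (simp add: abs_minus_commute)
  have "AE \<omega> in M. \<forall>t>0. is_local_max (\<lambda>s. \<phi>1 s + \<sigma> * B1 s \<omega>) t \<longrightarrow>
      \<not> is_local_max (\<lambda>s. \<phi>2 s + \<rho>1 * B1 s \<omega> + \<rho>2 * B2 s \<omega>) t"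
    by (rule no_common_local_max_positive_time[OF W(1,3) indep_processes_time_change[OF ind] H1 H2 assms(7,8)])
  moreover have "AE \<omega> in M. \<forall>t>0. is_local_max (\<lambda>s. \<phi>1 (- s) + \<sigma> * B1 (- s) \<omega>) t \<longrightarrow>
      \<not> is_local_max (\<lambda>s. \<phi>2 (- s) + \<rho>1 * B1 (- s) \<omega> + \<rho>2 * B2 (- s) \<omega>) t"
    by (rule no_common_local_max_positive_time[OF W(2,4) indep_processes_time_change[OF ind] R1 R2 assms(7,8)])
  moreover have "AE \<omega> in M. \<not> is_local_max (\<lambda>s. \<phi>1 s + \<sigma> * B1 s \<omega>) 0"
    by (rule zero_not_local_max[OF W(1) H1 assms(7)])
  ultimately show ?thesis
  proof eventually_elim
    case (elim \<omega>)
    show ?case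
    proof (rule notI, elim exE conjE)
      fix t
      assume "is_local_max (\<lambda>s. X1 s \<omega>) t" "is_local_max (\<lambda>s. X2 s \<omega>) t"
      then have lm: "is_local_max (\<lambda>s. \<phi>1 s + \<sigma> * B1 s \<omega>) t"
        "is_local_max (\<lambda>s. \<phi>2 s + \<rho>1 * B1 s \<omega> + \<rho>2 * B2 s \<omega>) t"
        by (simp_all only: assms(9,10))
      consider "0 < t" | "t = 0" | "0 < - t" by linarith
      then show False
      proof cases
        case 1
        from elim(1)[rule_format, OF 1 lm(1)] lm(2) show False by (rule notE)
      next
        case 2
        then show False using elim(3) lm by simp
      next
        case 3
        from elim(2)[rule_format, OF 3 is_local_max_reflect[OF lm(1)]] is_local_max_reflect[OF lm(2)]
        show False by (rule notE)
      qed
    qed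
  qed
qed

end
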